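(* Let $T>0$, $K>0$, and fix $u_0\in AC([-1,0])$. For every fixed $x\in AC_{u_0}([0,T])$, the mapping $$\mathfrak m_T\ni\mu\mapsto\mathfrak G_\mu(x)\in AC([0,T])$$ is $(\Sigma_T,\mathfrak B(AC([0,T])))$-measurable.
   Context: Let $\mathfrak m$ be the set of finite signed Borel measures on $[-1,0]$ with total variation norm at most $K$. $\mathfrak m_T$ is the set of all maps $\mu:[0,T]\to\mathfrak m$, $t\mapsto\mu_t$, such that for every $f\in C([-1,0])$ the function $t\mapsto\int_{[-1,0]}f\,d\mu_t$ is Lebesgue measurable on $[0,T]$. For a compact interval $[a,b]$, $AC([a,b])$ is the Banach space of real absolutely continuous functions with norm $\|u\|_{AC}=|u(a)|+\int_a^b|u'(t)|\,dt$, and $\mathfrak B$ denotes the Borel $\sigma$-algebra. $AC_{u_0}([0,T])=\{v\in AC([0,T]):v(0)=u_0(0)\}$; every $x\in AC_{u_0}([0,T])$ is extended to $[-1,0]$ by $x=u_0$ there. The continuation operator is $\mathfrak G_\mu(x)[t]=u_0(0)+\int_0^t\int_{[-1,0]}x(\tau+s)\,d\mu_\tau(s)\,d\tau$, $t\in[0,T]$. $\Sigma_T$ is the smallest $\sigma$-algebra on $\mathfrak m_T$ making all scalar maps $\mu\mapsto\int_0^t\int_{[-1,0]}y(\tau+s)\,d\mu_\tau(s)\,d\tau$, with $y\in AC([-1,T])$ and $t\in[0,T]$, Borel measurable. *)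

theory Defs
  imports "HOL-Analysis.Analysis"
begin

section \<open>Finite signed measures\<close>

text \<open>
  A finite signed measure is a real-valued, countably additive set function on the
  sigma-algebra of \<open>M\<close>; only \<open>space M\<close> and \<open>sets M\<close> matter. Set functions are fixed to
  \<^const>\<open>undefined\<close> off the sigma-algebra, so that equality is equality of signed measures.
  Additivity applied to the constant sequence of empty sets yields \<open>\<nu> {} = 0\<close>.
\<close>

definition signed_measure :: "'a measure \<Rightarrow> ('a set \<Rightarrow> real) \<Rightarrow> bool" where
  "signed_measure M \<nu> \<longleftrightarrow>
     \<nu> \<in> extensional (sets M) \<and>
     (\<forall>A :: nat \<Rightarrow> 'a set. range A \<subseteq> sets M \<longrightarrow> disjoint_family A \<longrightarrow>
        (\<lambda>n. \<nu> (A n)) sums \<nu> (\<Union>n. A n))"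

definition tv_norm :: "'a measure \<Rightarrow> ('a set \<Rightarrow> real) \<Rightarrow> ennreal" where
  "tv_norm M \<nu> =
     (SUP P \<in> {P. finite P \<and> P \<subseteq> sets M \<and> disjoint P \<and> \<Union>P = space M}.
        \<Sum>A\<in>P. ennreal \<bar>\<nu> A\<bar>)"

text \<open>
  The positive part of the Jordan decomposition, \<open>\<nu>\<^sup>+ A = sup {\<nu> B | B \<subseteq> A}\<close>. The
  truncation of negative values by \<^const>\<open>ennreal\<close> is harmless, since \<open>B = {}\<close> is allowed.
  The negative part of \<open>\<nu>\<close> is the positive part of \<open>- \<nu>\<close>.
\<close>

definition jordan_pos :: "'a measure \<Rightarrow> ('a set \<Rightarrow> real) \<Rightarrow> 'a measure" where
  "jordan_pos M \<nu> =
     measure_of (space M) (sets M) (\<lambda>A. SUP B \<in> {B \<in> sets M. B \<subseteq> A}. ennreal (\<nu> B))"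

definition signed_integral :: "'a measure \<Rightarrow> ('a set \<Rightarrow> real) \<Rightarrow> ('a \<Rightarrow> real) \<Rightarrow> real" where
  "signed_integral M \<nu> f =
     (\<integral>s. f s \<partial>jordan_pos M \<nu>) - (\<integral>s. f s \<partial>jordan_pos M (\<lambda>A. - \<nu> A))"

text \<open>
  \<^const>\<open>measure_of\<close> silently returns the zero measure on a set function that is not a
  measure; the following shows that this does not happen in \<^const>\<open>jordan_pos\<close>.
\<close>

lemma emeasure_jordan_pos:
  assumes "\<And>A :: nat \<Rightarrow> 'a set. range A \<subseteq> sets M \<Longrightarrow> disjoint_family A \<Longrightarrow>
             (\<lambda>n. \<nu> (A n)) sums \<nu> (\<Union>n. A n)"
    and "A \<in> sets M"
  shows "emeasure (jordan_pos M \<nu>) A = (SUP B \<in> {B \<in> sets M. B \<subseteq> A}. ennreal (\<nu> B))"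
proof -
  define F where "F A = (SUP B \<in> {B \<in> sets M. B \<subseteq> A}. ennreal (\<nu> B))" for A
  have "(\<lambda>n::nat. \<nu> {}) sums \<nu> {}"
    using assms(1)[of "\<lambda>_. {}"] by (simp add: disjoint_family_on_def)
  then have "(\<lambda>n::nat. \<nu> {}) \<longlonglongrightarrow> 0"
    by (intro summable_LIMSEQ_zero sums_summable)
  then have emp: "\<nu> {} = 0"
    by (simp add: LIMSEQ_const_iff)
  have add: "\<nu> (B \<union> C) = \<nu> B + \<nu> C" if "B \<in> sets M" "C \<in> sets M" "B \<inter> C = {}" for B C
  proof -
    have "(\<lambda>n. \<nu> (binaryset B C n)) sums \<nu> (\<Union>n. binaryset B C n)"
      using that by (intro assms(1))
        (auto simp: range_binaryset_eq disjoint_family_on_def binaryset_def)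
    moreover have "(\<lambda>n. \<nu> (binaryset B C n)) sums (\<nu> B + \<nu> C)"
      using emp by (intro binaryset_sums)
    ultimately show ?thesis
      by (simp add: UN_binaryset_eq sums_iff)
  qed
  have le_F: "ennreal (\<nu> B) \<le> F A" if "B \<in> sets M" "B \<subseteq> A" for A B
    unfolding F_def using that by (intro SUP_upper) auto
  have super: "F A + F B \<le> F (A \<union> B)" if "A \<inter> B = {}" for A B
  proof -
    have 1: "ennreal (\<nu> C) + ennreal (\<nu> D) \<le> F (A \<union> B)"
      if CD: "C \<in> sets M" "C \<subseteq> A" "D \<in> sets M" "D \<subseteq> B" for C D
    proof -
      consider "\<nu> C \<le> 0" | "\<nu> D \<le> 0" | "0 \<le> \<nu> C" "0 \<le> \<nu> D" by linarith
      then show ?thesis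
      proof cases
        case 1
        then show ?thesis using le_F[of D "A \<union> B"] CD by (auto simp: ennreal_neg)
      next
        case 2
        then show ?thesis using le_F[of C "A \<union> B"] CD by (auto simp: ennreal_neg)
      next
        case 3
        have "C \<inter> D = {}" using CD \<open>A \<inter> B = {}\<close> by auto
        then have "ennreal (\<nu> C) + ennreal (\<nu> D) = ennreal (\<nu> (C \<union> D))"
          using 3 CD by (simp add: add ennreal_plus)
        also have "\<dots> \<le> F (A \<union> B)" using CD by (intro le_F) auto
        finally show ?thesis .
      qed
    qed
    have ne: "{C \<in> sets M. C \<subseteq> X} \<noteq> {}" for X by auto
    have 2: "F A + ennreal (\<nu> D) \<le> F (A \<union> B)" if D: "D \<in> sets M" "D \<subseteq> B" for D
    proof -
      have "F A + ennreal (\<nu> D) = (SUP C \<in> {C \<in> sets M. C \<subseteq> A}. ennreal (\<nu> C) + ennreal (\<nu> D))"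
        unfolding F_def by (rule ennreal_SUP_add_left[OF ne, symmetric])
      also have "\<dots> \<le> F (A \<union> B)" using 1 D by (intro SUP_least) auto
      finally show ?thesis .
    qed
    have "F A + F B = (SUP D \<in> {D \<in> sets M. D \<subseteq> B}. F A + ennreal (\<nu> D))"
      unfolding F_def[of B] by (rule ennreal_SUP_add_right[OF ne])
    also have "\<dots> \<le> F (A \<union> B)" using 2 by (intro SUP_least) auto
    finally show ?thesis .
  qed
  have mono: "F A \<le> F B" if "A \<subseteq> B" for A B
    unfolding F_def using that by (intro SUP_subset_mono) auto
  have "F {} \<le> 0"
    unfolding F_def using emp by (intro SUP_least) auto
  then have "positive (sets M) F"
    unfolding positive_def by simp
  moreover have "countably_additive (sets M) F"
  proof (rule countably_additiveI)
    fix A :: "nat \<Rightarrow> 'a set"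
    assume A: "range A \<subseteq> sets M" "disjoint_family A" "(\<Union>n. A n) \<in> sets M"
    have part: "(\<Sum>i<n. F (A i)) \<le> F (\<Union>i<n. A i)" for n
    proof (induction n)
      case (Suc n)
      have "A i \<inter> A n = {}" if "i < n" for i
        using disjoint_family_onD[OF A(2), of i n] that by simp
      then have "(\<Union>i<n. A i) \<inter> A n = {}"
        by blast
      from super[OF this] have "(\<Sum>i<n. F (A i)) + F (A n) \<le> F ((\<Union>i<n. A i) \<union> A n)"
        by (rule order_trans[OF add_right_mono[OF Suc]])
      then show ?case
        unfolding sum.lessThan_Suc by (simp only: lessThan_Suc UN_insert Un_commute)
    qed simp
    have "(\<Sum>n. F (A n)) \<le> F (\<Union>n. A n)"
      by (intro suminf_le_const) (auto intro!: order_trans[OF part] mono)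
    moreover have "F (\<Union>n. A n) \<le> (\<Sum>n. F (A n))"
      unfolding F_def[of "\<Union>n. A n"]
    proof (intro SUP_least)
      fix B assume B: "B \<in> {B \<in> sets M. B \<subseteq> (\<Union>n. A n)}"
      have "(\<lambda>n. \<nu> (B \<inter> A n)) sums \<nu> (\<Union>n. B \<inter> A n)"
        using A B by (intro assms(1)) (auto simp: disjoint_family_on_def)
      moreover have "(\<Union>n. B \<inter> A n) = B" using B by auto
      ultimately have "(\<lambda>n. ennreal (\<Sum>i<n. \<nu> (B \<inter> A i))) \<longlonglongrightarrow> ennreal (\<nu> B)"
        unfolding sums_def by (intro tendsto_ennrealI) simp
      moreover have "ennreal (\<Sum>i<n. \<nu> (B \<inter> A i)) \<le> (\<Sum>n. F (A n))" for n
      proof -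
        have "ennreal (\<Sum>i<n. \<nu> (B \<inter> A i)) \<le> ennreal (\<Sum>i<n. max 0 (\<nu> (B \<inter> A i)))"
          by (intro ennreal_leI sum_mono) auto
        also have "\<dots> = (\<Sum>i<n. ennreal (\<nu> (B \<inter> A i)))"
          by (subst sum_ennreal[symmetric])
            (auto intro!: sum.cong simp: max_def ennreal_neg simp del: sum_ennreal)
        also have "\<dots> \<le> (\<Sum>i<n. F (A i))"
          using A B by (intro sum_mono le_F) auto
        also have "\<dots> \<le> (\<Sum>n. F (A n))"
          by (intro sum_le_suminf) auto
        finally show ?thesis .
      qed
      ultimately show "ennreal (\<nu> B) \<le> (\<Sum>n. F (A n))"
        by (intro LIMSEQ_le_const2) auto
    qed
    ultimately show "(\<Sum>n. F (A n)) = F (\<Union>n. A n)" by (rule antisym)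
  qed
  moreover have "jordan_pos M \<nu> = measure_of (space M) (sets M) F"
    unfolding jordan_pos_def F_def ..
  ultimately show ?thesis
    using assms(2) by (simp add: emeasure_measure_of_sigma sets.sigma_algebra_axioms F_def)
qed


section \<open>Absolutely continuous functions\<close>

text \<open>
  Functions on \<open>[a,b]\<close> are represented by extensional functions. The intervals
  \<open>(c i, d i)\<close> may be empty; such indices contribute nothing.
\<close>

definition abs_cont :: "real \<Rightarrow> real \<Rightarrow> (real \<Rightarrow> real) \<Rightarrow> bool" where
  "abs_cont a b u \<longleftrightarrow>
     (\<forall>\<epsilon>>0. \<exists>\<delta>>0. \<forall>(n::nat) c d.
        (\<forall>i<n. a \<le> c i \<and> c i \<le> d i \<and> d i \<le> b) \<longrightarrow>
        disjoint_family_on (\<lambda>i. {c i<..<d i}) {..<n} \<longrightarrow>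
        (\<Sum>i<n. d i - c i) < \<delta> \<longrightarrow> (\<Sum>i<n. \<bar>u (d i) - u (c i)\<bar>) < \<epsilon>)"

definition AC :: "real \<Rightarrow> real \<Rightarrow> (real \<Rightarrow> real) set" where
  "AC a b = {u \<in> extensional {a..b}. abs_cont a b u}"

text \<open>
  An absolutely continuous function is differentiable almost everywhere; the unspecified values
  of \<^const>\<open>deriv\<close> on the exceptional null set (which contains the endpoints, where
  the extensional representative may jump) do not affect the integral.
\<close>

definition AC_norm :: "real \<Rightarrow> real \<Rightarrow> (real \<Rightarrow> real) \<Rightarrow> real" where
  "AC_norm a b u = \<bar>u a\<bar> + (LINT t:{a..b}|lebesgue. \<bar>deriv u t\<bar>)"

definition borel_AC :: "real \<Rightarrow> real \<Rightarrow> (real \<Rightarrow> real) measure" where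
  "borel_AC a b =
     sigma (AC a b)
       {U. openin (Metric_space.mtopology (AC a b) (\<lambda>u v. AC_norm a b (\<lambda>t. u t - v t))) U}"

definition AC_from :: "(real \<Rightarrow> real) \<Rightarrow> real \<Rightarrow> (real \<Rightarrow> real) set" where
  "AC_from u0 T = {v \<in> AC 0 T. v 0 = u0 0}"

definition extend :: "(real \<Rightarrow> real) \<Rightarrow> (real \<Rightarrow> real) \<Rightarrow> real \<Rightarrow> real" where
  "extend u0 x = (\<lambda>r. if r \<le> 0 then u0 r else x r)"


section \<open>Measure-valued controls and the continuation operator\<close>

abbreviation delay_interval :: "real measure" where
  "delay_interval \<equiv> restrict_space borel {-1..0}"

definition ms :: "real \<Rightarrow> (real set \<Rightarrow> real) set" where
  "ms K = {\<nu>. signed_measure delay_interval \<nu> \<and> tv_norm delay_interval \<nu> \<le> ennreal K}"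

definition ms_T :: "real \<Rightarrow> real \<Rightarrow> (real \<Rightarrow> real set \<Rightarrow> real) set" where
  "ms_T K T =
     {\<mu> \<in> {0..T} \<rightarrow>\<^sub>E ms K.
        \<forall>f. continuous_on {-1..0} f \<longrightarrow>
          (\<lambda>t. signed_integral delay_interval (\<mu> t) f) \<in> borel_measurable (lebesgue_on {0..T})}"

definition delay_integral :: "(real \<Rightarrow> real) \<Rightarrow> (real \<Rightarrow> real set \<Rightarrow> real) \<Rightarrow> real \<Rightarrow> real" where
  "delay_integral y \<mu> t =
     (LINT \<tau>:{0..t}|lebesgue. signed_integral delay_interval (\<mu> \<tau>) (\<lambda>s. y (\<tau> + s)))"

definition continuation ::
    "(real \<Rightarrow> real) \<Rightarrow> real \<Rightarrow> (real \<Rightarrow> real set \<Rightarrow> real) \<Rightarrow> (real \<Rightarrow> real) \<Rightarrow> real \<Rightarrow> real" where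
  "continuation u0 T \<mu> x = (\<lambda>t\<in>{0..T}. u0 0 + delay_integral (extend u0 x) \<mu> t)"

definition Sigma_T :: "real \<Rightarrow> real \<Rightarrow> (real \<Rightarrow> real set \<Rightarrow> real) measure" where
  "Sigma_T K T =
     sigma (ms_T K T)
       {{\<mu> \<in> ms_T K T. delay_integral y \<mu> t \<in> B} | y t B.
          y \<in> AC (-1) T \<and> t \<in> {0..T} \<and> B \<in> sets borel}"

end

theory Submission
  imports Defs
begin

text \<open>
  The generators of \<open>\<Sigma>\<^sub>T\<close> only give access to the values \<open>G\<^sub>\<mu>(x)[t]\<close> at single times, whereas
  the AC norm sees the derivative. The gap is closed as in Pettis' measurability theorem:
  a map into a separable part of a metric space is Borel measurable as soon as its distances to
  the points of a countable dense set are measurable.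

  Separability. The derivative of \<open>G\<^sub>\<mu>(x)\<close> is the bounded measurable function
  \<open>\<tau> \<mapsto> \<integral> x(\<tau> + s) d\<mu>\<^sub>\<tau>(s)\<close> (\<open>delay_integrand\<close>), so \<open>G\<^sub>\<mu>(x)\<close> is approximated in AC by
  primitives \<open>q\<close> of step functions on uniform partitions with rational values
  (\<open>rational_step_dense\<close>). There are countably many sets \<open>{\<mu>. dist G\<^sub>\<mu>(x) q < 1/(k+1)}\<close>, and the
  inverse image of an open subset of AC is the union of those among them that it contains.

  Distances. For a primitive \<open>u\<close> of a bounded function, the integral of \<open>\<bar>u'\<bar>\<close> is the limit of the
  sums \<open>\<Sum>\<bar>u(t\<^sub>i\<^sub>+\<^sub>1) - u(t\<^sub>i)\<bar>\<close> along uniform partitions (\<open>polygonal_variation_tendsto\<close>), because the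
  difference quotients over the cells converge almost everywhere and boundedly to \<open>u'\<close>. Applied to
  \<open>u = G\<^sub>\<mu>(x) - q\<close>, this exhibits the distance as a limit of expressions in finitely many values
  \<open>G\<^sub>\<mu>(x)[t]\<close>, and these are \<open>\<Sigma>\<^sub>T\<close>-measurable.

  Both halves rest on Lebesgue's differentiation theorem, obtained from Vitali's covering
  theorem. It is also needed, together with the fact that every absolutely continuous function is
  an indefinite integral (variation, Stieltjes measure, Radon-Nikodym), to know that the AC norm
  induces a metric, on which the meaning of the Borel sets of AC rests.
\<close>


section \<open>Lebesgue's differentiation theorem\<close>

text \<open>
  Absolute continuity of the integral: cut \<open>\<bar>f\<bar>\<close> at a height \<open>k\<close> so large that the part above \<open>k\<close>
  has small integral; the part below contributes at most \<open>k\<close> times the measure of the set.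
\<close>

lemma set_integral_abs_small:
  fixes f :: "'a \<Rightarrow> real"
  assumes f: "integrable M f" and e: "e > 0"
  obtains \<delta> where "\<delta> > 0"
    "\<And>S. S \<in> sets M \<Longrightarrow> emeasure M S < ennreal \<delta> \<Longrightarrow> (LINT x:S|M. \<bar>f x\<bar>) < e"
proof -
  have [measurable]: "f \<in> borel_measurable M" using f by auto
  have "(\<lambda>k::nat. \<integral>x. \<bar>f x\<bar> - min (\<bar>f x\<bar>) (real k) \<partial>M) \<longlonglongrightarrow> (\<integral>x. 0 \<partial>M)"
  proof (rule integral_dominated_convergence[where w="\<lambda>x. \<bar>f x\<bar>"])
    show "AE x in M. (\<lambda>k. \<bar>f x\<bar> - min (\<bar>f x\<bar>) (real k)) \<longlonglongrightarrow> 0"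
    proof (rule AE_I2, rule tendsto_eventually)
      fix x
      obtain N :: nat where "\<bar>f x\<bar> \<le> real N" using real_arch_simple by blast
      then show "\<forall>\<^sub>F k in sequentially. \<bar>f x\<bar> - min (\<bar>f x\<bar>) (real k) = 0"
        unfolding eventually_sequentially by (intro exI[of _ N]) auto
    qed
  qed (use f in \<open>auto\<close>)
  then have "\<forall>\<^sub>F k in sequentially. (\<integral>x. \<bar>f x\<bar> - min (\<bar>f x\<bar>) (real k) \<partial>M) < e/2"
    using e by (intro order_tendstoD) auto
  then obtain k :: nat where k: "(\<integral>x. \<bar>f x\<bar> - min (\<bar>f x\<bar>) (real k) \<partial>M) < e/2"
    unfolding eventually_sequentially by blast
  have int: "integrable M (\<lambda>x. \<bar>f x\<bar> - min (\<bar>f x\<bar>) (real k))"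
    by (rule Bochner_Integration.integrable_bound[where f="\<lambda>x. \<bar>f x\<bar>"]) (use f in auto)
  show ?thesis
  proof
    show "e / (2 * (real k + 1)) > 0" using e by simp
    fix S assume S[measurable]: "S \<in> sets M" and small: "emeasure M S < ennreal (e / (2 * (real k + 1)))"
    have fin: "emeasure M S < \<infinity>" using small by (auto intro: less_trans)
    have mS: "measure M S \<le> e / (2 * (real k + 1))"
      unfolding measure_def using small e by (intro enn2real_leI) auto
    have "(LINT x:S|M. \<bar>f x\<bar>) \<le> (\<integral>x. real k * indicator S x + (\<bar>f x\<bar> - min (\<bar>f x\<bar>) (real k)) \<partial>M)"
      unfolding set_lebesgue_integral_def
    proof (rule integral_mono)
      show "integrable M (\<lambda>x. indicat_real S x *\<^sub>R \<bar>f x\<bar>)"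
        using f by (intro integrable_mult_indicator) auto
      show "integrable M (\<lambda>x. real k * indicat_real S x + (\<bar>f x\<bar> - min (\<bar>f x\<bar>) (real k)))"
        using int fin by (intro Bochner_Integration.integrable_add integrable_mult_right integrable_real_indicator) auto
    qed (auto simp: indicator_def)
    also have "\<dots> = real k * measure M S + (\<integral>x. \<bar>f x\<bar> - min (\<bar>f x\<bar>) (real k) \<partial>M)"
      using int fin by (subst Bochner_Integration.integral_add) (auto intro!: integrable_real_indicator)
    also have "real k * measure M S \<le> (real k + 1) * (e / (2 * (real k + 1)))"
      using mS by (intro mult_mono) auto
    also have "\<dots> = e / 2" by (simp add: divide_simps)
    finally show "(LINT x:S|M. \<bar>f x\<bar>) < e" using k by linarith
  qed
qed

text \<open>
  Here \<open>A = {f < p}\<close> is enclosed, up to a set \<open>G\<close> that is small for Lebesgue measure and for the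
  integral of \<open>\<bar>f\<bar>\<close>, in an open set \<open>W\<close>. By Vitali, disjoint intervals inside \<open>W\<close> on which the average
  of \<open>f\<close> exceeds \<open>q\<close> cover almost all of the exceptional set. On their union \<open>f - p\<close> is positive
  only within \<open>G\<close>, while its integral is at least \<open>q - p\<close> times the total length; so the total
  length is small. This covers the possibly nonmeasurable exceptional set by sets of small measure.
\<close>

lemma negligible_upper_average:
  fixes f :: "real \<Rightarrow> real"
  assumes f: "integrable lebesgue f" and pq: "p < q"
  shows "negligible {x. f x < p \<and> (\<forall>\<delta>>0. \<exists>c d. c < d \<and> c \<le> x \<and> x \<le> d \<and> d - c < \<delta> \<and>
           q * (d - c) < (LINT t:{c..d}|lebesgue. f t))}" (is "negligible ?E")
proof (subst negligible_on_intervals, intro allI iffD2[OF negligible_outer_le] impI)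
  fix a b e :: real assume e: "e > 0"
  have [measurable]: "f \<in> borel_measurable lebesgue" using f by auto
  define \<eta> where "\<eta> = e * (q - p)"
  have \<eta>: "\<eta> > 0" using e pq by (simp add: \<eta>_def)
  obtain \<delta> where \<delta>: "\<delta> > 0"
    "\<And>S. S \<in> sets lebesgue \<Longrightarrow> emeasure lebesgue S < ennreal \<delta> \<Longrightarrow> (LINT x:S|lebesgue. \<bar>f x\<bar>) < \<eta>/2"
    using set_integral_abs_small[OF f, of "\<eta>/2"] \<eta> by auto
  \<comment> \<open>each of the two terms of \<open>\<integral>\<^sub>G (\<bar>f\<bar> + \<bar>p\<bar>)\<close> gets at most \<open>\<eta>/2\<close>\<close>
  define \<delta>' where "\<delta>' = min \<delta> (\<eta> / (2 * (\<bar>p\<bar> + 1)))"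
  have \<delta>': "\<delta>' > 0" using \<delta>(1) \<eta> by (simp add: \<delta>'_def)
  define A where "A = {x. f x < p} \<inter> {a..b}"
  have "{x \<in> space lebesgue. f x < p} \<in> sets lebesgue" by measurable
  then have A[measurable]: "A \<in> sets lebesgue" unfolding A_def by (intro sets.Int) auto
  obtain W where W: "open W" "A \<subseteq> W" "W - A \<in> lmeasurable" "emeasure lebesgue (W - A) < ennreal \<delta>'"
    using sets_lebesgue_outer_open[OF A \<delta>'] by blast
  define G where "G = W - A"
  have G[measurable]: "G \<in> sets lebesgue" using W(3) by (auto simp: G_def)
  have Gfin: "G \<in> lmeasurable" using W(3) by (simp add: G_def)
  have intG: "(LINT x:G|lebesgue. \<bar>f x\<bar>) < \<eta>/2"
    by (intro \<delta>(2) G less_le_trans[OF W(4)[folded G_def]] ennreal_leI) (simp add: \<delta>'_def)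
  have "measure lebesgue G \<le> \<delta>'"
    unfolding measure_def G_def using W(4) \<delta>' by (intro enn2real_leI) auto
  also have "\<dots> \<le> \<eta> / (2 * (\<bar>p\<bar> + 1))" by (simp add: \<delta>'_def)
  finally have mG: "measure lebesgue G * (\<bar>p\<bar> + 1) \<le> \<eta> / 2"
    by (simp add: pos_le_divide_eq field_simps)
  define I where "I = (\<lambda>i::real\<times>real. {fst i..snd i})"
  define J where "J = {i. fst i < snd i \<and> I i \<subseteq> W \<and>
     q * (snd i - fst i) < (LINT t:I i|lebesgue. f t)}"
  have cball_I: "cball ((fst i + snd i) / 2) ((snd i - fst i) / 2) = I i" for i
    by (simp add: I_def cball_eq_atLeastAtMost field_simps)
  obtain C where C: "countable C" "C \<subseteq> J"
    "pairwise (\<lambda>i j. disjnt (I i) (I j)) C"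
    "negligible (?E \<inter> {a..b} - (\<Union>i\<in>C. I i))"
  proof (rule Vitali_covering_theorem_cballs[of J "\<lambda>i. (snd i - fst i) / 2" "?E \<inter> {a..b}" "\<lambda>i. (fst i + snd i) / 2"])
    show "0 < (snd i - fst i) / 2" if "i \<in> J" for i using that by (simp add: J_def)
    fix x d :: real assume x: "x \<in> ?E \<inter> {a..b}" and d: "0 < d"
    have "x \<in> W" using x W(2) by (auto simp: A_def)
    then obtain r where r: "r > 0" "cball x r \<subseteq> W" using W(1) open_contains_cball by blast
    have "min d r > 0" using d r by simp
    with x obtain u v where uv: "u < v" "u \<le> x" "x \<le> v" "v - u < min d r"
      "q * (v - u) < (LINT t:{u..v}|lebesgue. f t)"
      by blast
    have "I (u,v) \<subseteq> cball x r" using uv by (auto simp: I_def dist_real_def)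
    then have "(u,v) \<in> J" using uv r by (auto simp: J_def I_def)
    then show "\<exists>i. i \<in> J \<and> x \<in> cball ((fst i + snd i) / 2) ((snd i - fst i) / 2) \<and> (snd i - fst i) / 2 < d"
      unfolding cball_I using uv d by (intro exI[of _ "(u,v)"]) (auto simp: I_def)
  qed (auto simp: cball_I)
  have fin_bound: "measure lebesgue (\<Union>i\<in>F. I i) \<le> e" if F: "F \<subseteq> C" "finite F" for F
  proof -
    define U where "U = (\<Union>i\<in>F. I i)"
    have Iin[simp]: "I i \<in> lmeasurable" for i by (simp add: I_def)
    have [measurable]: "I i \<in> sets lebesgue" for i by (simp add: I_def)
    have Um: "U \<in> lmeasurable" unfolding U_def using F by (intro fmeasurable.finite_UN) auto
    have [measurable]: "U \<in> sets lebesgue" using Um by auto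
    have disj: "disjoint_family_on I F"
      using C(3) F unfolding disjoint_family_on_def pairwise_def disjnt_def by (meson subsetD)
    have mU: "measure lebesgue U = (\<Sum>i\<in>F. snd i - fst i)"
    proof -
      have "measure lebesgue U = (\<Sum>i\<in>F. measure lebesgue (I i))"
        unfolding U_def using F disj by (intro measure_finite_Union) (auto simp: I_def emeasure_lborel_Icc_eq)
      also have "\<dots> = (\<Sum>i\<in>F. snd i - fst i)"
      proof (intro sum.cong refl)
        fix i assume "i \<in> F" then have "fst i < snd i" using F C(2) by (auto simp: J_def)
        then show "measure lebesgue (I i) = snd i - fst i" by (simp add: I_def)
      qed
      finally show ?thesis .
    qed
    have fi: "set_integrable lebesgue S f" if "S \<in> sets lebesgue" for S
      using f that unfolding set_integrable_def by (intro integrable_mult_indicator) auto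
    have fU: "(LINT x:U|lebesgue. f x) = (\<Sum>i\<in>F. LINT x:I i|lebesgue. f x)"
      unfolding U_def using F disj fi by (intro set_integral_finite_Union) auto
    have "(q - p) * measure lebesgue U = (\<Sum>i\<in>F. q * (snd i - fst i)) - p * measure lebesgue U"
      by (simp add: mU left_diff_distrib flip: sum_distrib_left)
    also have "\<dots> \<le> (LINT x:U|lebesgue. f x) - p * measure lebesgue U"
    proof -
      have "(\<Sum>i\<in>F. q * (snd i - fst i)) \<le> (\<Sum>i\<in>F. LINT x:I i|lebesgue. f x)"
        by (rule sum_mono) (use F C(2) in \<open>auto simp: J_def intro: less_imp_le\<close>)
      then show ?thesis by (simp add: fU)
    qed
    also have "\<dots> = (\<integral>x. indicator U x * f x - p * indicator U x \<partial>lebesgue)"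
      using fi[of U] Um by (subst Bochner_Integration.integral_diff)
        (auto simp: set_integrable_def set_lebesgue_integral_def fmeasurable_def)
    also have "\<dots> \<le> (\<integral>x. indicator G x * \<bar>f x\<bar> + \<bar>p\<bar> * indicator G x \<partial>lebesgue)"
    proof (rule integral_mono)
      show "integrable lebesgue (\<lambda>x. indicat_real U x * f x - p * indicat_real U x)"
        using fi[of U] Um by (auto simp: set_integrable_def fmeasurable_def)
      show "integrable lebesgue (\<lambda>x. indicat_real G x * \<bar>f x\<bar> + \<bar>p\<bar> * indicat_real G x)"
        using set_integrable_abs[OF fi[of G]] Gfin by (auto simp: set_integrable_def fmeasurable_def)
      fix x
      have "x \<in> A \<or> x \<in> G" if "x \<in> U"
        using that F(1) C(2) by (auto simp: U_def J_def G_def)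
      then show "indicat_real U x * f x - p * indicat_real U x \<le> indicat_real G x * \<bar>f x\<bar> + \<bar>p\<bar> * indicat_real G x"
        by (auto simp: indicator_def A_def)
    qed
    also have "\<dots> = (LINT x:G|lebesgue. \<bar>f x\<bar>) + \<bar>p\<bar> * measure lebesgue G"
      using set_integrable_abs[OF fi[of G]] Gfin
      by (subst Bochner_Integration.integral_add)
        (auto simp: set_integrable_def set_lebesgue_integral_def fmeasurable_def)
    also have "\<dots> \<le> \<eta>"
    proof -
      have "\<bar>p\<bar> * measure lebesgue G \<le> measure lebesgue G * (\<bar>p\<bar> + 1)"
        by (simp add: algebra_simps)
      then show ?thesis using intG mG by linarith
    qed
    finally have "(q - p) * measure lebesgue U \<le> (q - p) * e" by (simp add: \<eta>_def mult.commute)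
    then show ?thesis using pq by (simp add: U_def)
  qed
  have UC: "(\<Union>i\<in>C. I i) \<in> lmeasurable" "measure lebesgue (\<Union>i\<in>C. I i) \<le> e"
    using fmeasurable_UN_bound[of C I lebesgue e] measure_UN_bound[of C I lebesgue e] C(1) fin_bound
    by (auto simp: I_def)
  define N where "N = ?E \<inter> {a..b} - (\<Union>i\<in>C. I i)"
  have N: "negligible N" using C(4) unfolding N_def .
  show "\<exists>S. ?E \<inter> cbox a b \<subseteq> S \<and> S \<in> lmeasurable \<and> measure lebesgue S \<le> e"
  proof (intro exI[of _ "(\<Union>i\<in>C. I i) \<union> N"] conjI)
    show "?E \<inter> cbox a b \<subseteq> (\<Union>i\<in>C. I i) \<union> N" by (auto simp: N_def)
    show "(\<Union>i\<in>C. I i) \<union> N \<in> lmeasurable"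
      by (rule fmeasurable.Un[OF UC(1) negligible_imp_measurable[OF N]])
    have "measure lebesgue ((\<Union>i\<in>C. I i) \<union> N) \<le> measure lebesgue (\<Union>i\<in>C. I i) + measure lebesgue N"
      using UC(1) N by (intro measure_Un_le fmeasurableD negligible_imp_sets)
    then show "measure lebesgue ((\<Union>i\<in>C. I i) \<union> N) \<le> e"
      using UC(2) N by (simp add: negligible_imp_measure0)
  qed
qed

text \<open>
  The intervals merely contain \<open>x\<close> instead of being centred there. This form gives the
  derivative of the indefinite integral, and also the convergence of averages over the cells of
  partitions. Failure at \<open>x\<close> with error \<open>e\<close> leaves room for rationals \<open>f x < p < q < f x + e\<close> or the
  same for \<open>- f\<close>, so countably many negligible sets cover the exceptional points.
\<close>

theorem lebesgue_differentiation:
  fixes f :: "real \<Rightarrow> real"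
  assumes f: "integrable lebesgue f"
  shows "AE x in lebesgue. \<forall>e>0. \<exists>\<delta>>0. \<forall>c d. c < d \<longrightarrow> c \<le> x \<longrightarrow> x \<le> d \<longrightarrow> d - c < \<delta> \<longrightarrow>
           \<bar>(LINT t:{c..d}|lebesgue. f t) - f x * (d - c)\<bar> \<le> e * (d - c)"
proof -
  define N where "N g pq = {x. g x < fst pq \<and> (\<forall>\<delta>>0. \<exists>c d. c < d \<and> c \<le> x \<and> x \<le> d \<and> d - c < \<delta> \<and>
           snd pq * (d - c) < (LINT t:{c..d}|lebesgue. g t))}" for g :: "real \<Rightarrow> real" and pq :: "real \<times> real"
  define Q where "Q = {pq \<in> \<rat> \<times> \<rat>. fst pq < snd (pq :: real \<times> real)}"
  have cQ: "countable Q"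
    unfolding Q_def by (rule countable_subset[of _ "\<rat> \<times> \<rat>"]) (auto intro: countable_rat)
  have neg: "negligible (\<Union>pq\<in>Q. N g pq)" if "integrable lebesgue g" for g
    using negligible_upper_average[OF that] cQ
    by (intro negligible_countable_Union) (auto simp: Q_def N_def)
  have AEN: "AE x in lebesgue. x \<notin> (\<Union>pq\<in>Q. N g pq)" if "integrable lebesgue g" for g
    using neg[OF that] by (intro AE_not_in) (simp add: negligible_iff_null_sets)
  have upper: "\<exists>\<delta>>0. \<forall>c d. c < d \<longrightarrow> c \<le> x \<longrightarrow> x \<le> d \<longrightarrow> d - c < \<delta> \<longrightarrow>
           (LINT t:{c..d}|lebesgue. g t) \<le> (g x + e) * (d - c)"
    if x: "x \<notin> (\<Union>pq\<in>Q. N g pq)" and e: "e > 0" for g x e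
  proof -
    obtain p where p: "p \<in> \<rat>" "g x < p" "p < g x + e"
      using Rats_dense_in_real[of "g x" "g x + e"] e by auto
    obtain q where q: "q \<in> \<rat>" "p < q" "q < g x + e"
      using Rats_dense_in_real[OF p(3)] by auto
    have "(p, q) \<in> Q" using p q by (simp add: Q_def)
    then have "x \<notin> N g (p, q)" using x by blast
    then obtain \<delta> where \<delta>: "\<delta> > 0" "\<And>c d. c < d \<Longrightarrow> c \<le> x \<Longrightarrow> x \<le> d \<Longrightarrow> d - c < \<delta> \<Longrightarrow>
        (LINT t:{c..d}|lebesgue. g t) \<le> q * (d - c)"
      using p by (force simp: N_def not_less)
    have "q * (d - c) \<le> (g x + e) * (d - c)" if "c < d" for c d
      using q that by (intro mult_right_mono) auto
    with \<delta> show ?thesis by (meson order_trans)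
  qed
  have mf: "integrable lebesgue (\<lambda>x. - f x)" using f by simp
  show ?thesis
    using AEN[OF f] AEN[OF mf]
  proof eventually_elim
    case (elim x)
    show ?case
    proof (intro allI impI)
      fix e :: real assume e: "e > 0"
      obtain \<delta>1 where 1: "\<delta>1 > 0" "\<And>c d. c < d \<Longrightarrow> c \<le> x \<Longrightarrow> x \<le> d \<Longrightarrow> d - c < \<delta>1 \<Longrightarrow>
           (LINT t:{c..d}|lebesgue. f t) \<le> (f x + e) * (d - c)"
        using upper[OF elim(1) e] by blast
      obtain \<delta>2 where 2: "\<delta>2 > 0" "\<And>c d. c < d \<Longrightarrow> c \<le> x \<Longrightarrow> x \<le> d \<Longrightarrow> d - c < \<delta>2 \<Longrightarrow>
           (LINT t:{c..d}|lebesgue. - f t) \<le> (- f x + e) * (d - c)"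
        using upper[OF elim(2) e] by blast
      have fi: "set_integrable lebesgue {c..d} f" for c d
        using f unfolding set_integrable_def by (intro integrable_mult_indicator) auto
      show "\<exists>\<delta>>0. \<forall>c d. c < d \<longrightarrow> c \<le> x \<longrightarrow> x \<le> d \<longrightarrow> d - c < \<delta> \<longrightarrow>
           \<bar>(LINT t:{c..d}|lebesgue. f t) - f x * (d - c)\<bar> \<le> e * (d - c)"
      proof (intro exI[of _ "min \<delta>1 \<delta>2"] conjI allI impI)
        fix c d assume cd: "c < d" "c \<le> x" "x \<le> d" "d - c < min \<delta>1 \<delta>2"
        have "(LINT t:{c..d}|lebesgue. f t) \<le> (f x + e) * (d - c)" using cd 1(2)[of c d] by simp
        moreover have "- (LINT t:{c..d}|lebesgue. f t) \<le> (- f x + e) * (d - c)"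
          using cd 2(2)[of c d] by (simp add: set_integral_uminus[OF fi])
        ultimately show "\<bar>(LINT t:{c..d}|lebesgue. f t) - f x * (d - c)\<bar> \<le> e * (d - c)"
          by (simp add: abs_le_iff algebra_simps)
      qed (use 1 2 in auto)
    qed
  qed
qed


section \<open>Variation of absolutely continuous functions\<close>

text \<open>
  Families of intervals arise below with pairs of numbers or sets as indices; this frees the
  definition of absolute continuity from its enumeration by natural numbers.
\<close>

lemma abs_cont_finite_family:
  fixes u :: "real \<Rightarrow> real"
  assumes "abs_cont a b u" "\<epsilon> > 0"
  obtains \<delta> where "\<delta> > 0"
    "\<And>(J :: 'i set) c d. finite J \<Longrightarrow> (\<And>i. i \<in> J \<Longrightarrow> a \<le> c i \<and> c i \<le> d i \<and> d i \<le> b) \<Longrightarrow>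
       disjoint_family_on (\<lambda>i. {c i<..<d i}) J \<Longrightarrow> (\<Sum>i\<in>J. d i - c i) < \<delta> \<Longrightarrow>
       (\<Sum>i\<in>J. \<bar>u (d i) - u (c i)\<bar>) < \<epsilon>"
proof -
  obtain \<delta> where \<delta>: "\<delta> > 0" "\<And>(n::nat) c d. (\<forall>i<n. a \<le> c i \<and> c i \<le> d i \<and> d i \<le> b) \<Longrightarrow>
        disjoint_family_on (\<lambda>i. {c i<..<d i}) {..<n} \<Longrightarrow>
        (\<Sum>i<n. d i - c i) < \<delta> \<Longrightarrow> (\<Sum>i<n. \<bar>u (d i) - u (c i)\<bar>) < \<epsilon>"
    using assms unfolding abs_cont_def by meson
  show ?thesis
  proof (rule that[OF \<delta>(1)])
    fix J :: "'i set" and c d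
    assume J: "finite J" "\<And>i. i \<in> J \<Longrightarrow> a \<le> c i \<and> c i \<le> d i \<and> d i \<le> b"
      "disjoint_family_on (\<lambda>i. {c i<..<d i}) J" "(\<Sum>i\<in>J. d i - c i) < \<delta>"
    obtain h where h: "bij_betw h {..<card J} J"
      using ex_bij_betw_nat_finite[OF J(1)] by (auto simp: atLeast0LessThan)
    have hJ: "h i \<in> J" if "i < card J" for i using h that by (auto simp: bij_betw_def)
    have "(\<Sum>i<card J. \<bar>u (d (h i)) - u (c (h i))\<bar>) < \<epsilon>"
    proof (rule \<delta>(2))
      show "disjoint_family_on (\<lambda>i. {c (h i)<..<d (h i)}) {..<card J}"
        using J(3) h hJ unfolding disjoint_family_on_def bij_betw_def
        by (metis (no_types, lifting) inj_on_def lessThan_iff)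
      show "(\<Sum>i<card J. d (h i) - c (h i)) < \<delta>"
        using J(4) sum.reindex_bij_betw[OF h, of "\<lambda>i. d i - c i"] by simp
    qed (use J hJ in auto)
    then show "(\<Sum>i\<in>J. \<bar>u (d i) - u (c i)\<bar>) < \<epsilon>"
      using sum.reindex_bij_betw[OF h, of "\<lambda>i. \<bar>u (d i) - u (c i)\<bar>"] by simp
  qed
qed

lemma abs_cont_imp_continuous_on:
  assumes "abs_cont a b u"
  shows "continuous_on {a..b} u"
  unfolding continuous_on_iff
proof (intro ballI allI impI)
  fix x e :: real assume x: "x \<in> {a..b}" and e: "e > 0"
  obtain \<delta> where \<delta>: "\<delta> > 0"
    "\<And>(J :: unit set) c d. finite J \<Longrightarrow> (\<And>i. i \<in> J \<Longrightarrow> a \<le> c i \<and> c i \<le> d i \<and> d i \<le> b) \<Longrightarrow>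
       disjoint_family_on (\<lambda>i. {c i<..<d i}) J \<Longrightarrow> (\<Sum>i\<in>J. d i - c i) < \<delta> \<Longrightarrow>
       (\<Sum>i\<in>J. \<bar>u (d i) - u (c i)\<bar>) < e"
    using abs_cont_finite_family[OF assms e] by blast
  have "dist (u y) (u x) < e" if y: "y \<in> {a..b}" "dist y x < \<delta>" for y
    using \<delta>(2)[of UNIV "\<lambda>_. min x y" "\<lambda>_. max x y"] x y
    by (cases "x \<le> y") (auto simp: disjoint_family_on_def dist_real_def min_def max_def)
  then show "\<exists>d>0. \<forall>x'\<in>{a..b}. dist x' x < d \<longrightarrow> dist (u x') (u x) < e" using \<delta>(1) by blast
qed

text \<open>
  One criterion that serves for sums of functions and for functions glued from two pieces.
\<close>

lemma abs_cont_combine: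
  fixes u v w :: "real \<Rightarrow> real"
  assumes "abs_cont a b u" "abs_cont a b v" 
    and le: "\<And>c d. a \<le> c \<Longrightarrow> c \<le> d \<Longrightarrow> d \<le> b \<Longrightarrow> \<bar>w d - w c\<bar> \<le> \<bar>u d - u c\<bar> + \<bar>v d - v c\<bar>"
  shows "abs_cont a b w"
  unfolding abs_cont_def
proof (intro allI impI)
  fix \<epsilon> :: real assume "\<epsilon> > 0"
  then have e: "\<epsilon>/2 > 0" by simp
  obtain \<delta>1 where 1: "\<delta>1 > 0" "\<And>(n::nat) c d. (\<forall>i<n. a \<le> c i \<and> c i \<le> d i \<and> d i \<le> b) \<Longrightarrow>
        disjoint_family_on (\<lambda>i. {c i<..<d i}) {..<n} \<Longrightarrow>
        (\<Sum>i<n. d i - c i) < \<delta>1 \<Longrightarrow> (\<Sum>i<n. \<bar>u (d i) - u (c i)\<bar>) < \<epsilon>/2"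
    using assms(1) e unfolding abs_cont_def by meson
  obtain \<delta>2 where 2: "\<delta>2 > 0" "\<And>(n::nat) c d. (\<forall>i<n. a \<le> c i \<and> c i \<le> d i \<and> d i \<le> b) \<Longrightarrow>
        disjoint_family_on (\<lambda>i. {c i<..<d i}) {..<n} \<Longrightarrow>
        (\<Sum>i<n. d i - c i) < \<delta>2 \<Longrightarrow> (\<Sum>i<n. \<bar>v (d i) - v (c i)\<bar>) < \<epsilon>/2"
    using assms(2) e unfolding abs_cont_def by meson
  show "\<exists>\<delta>>0. \<forall>(n::nat) c d. (\<forall>i<n. a \<le> c i \<and> c i \<le> d i \<and> d i \<le> b) \<longrightarrow>
        disjoint_family_on (\<lambda>i. {c i<..<d i}) {..<n} \<longrightarrow>
        (\<Sum>i<n. d i - c i) < \<delta> \<longrightarrow> (\<Sum>i<n. \<bar>w (d i) - w (c i)\<bar>) < \<epsilon>"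
  proof (intro exI[of _ "min \<delta>1 \<delta>2"] conjI allI impI)
    fix n :: nat and c d :: "nat \<Rightarrow> real"
    assume *: "\<forall>i<n. a \<le> c i \<and> c i \<le> d i \<and> d i \<le> b" "disjoint_family_on (\<lambda>i. {c i<..<d i}) {..<n}"
      "(\<Sum>i<n. d i - c i) < min \<delta>1 \<delta>2"
    have "(\<Sum>i<n. \<bar>w (d i) - w (c i)\<bar>) \<le> (\<Sum>i<n. \<bar>u (d i) - u (c i)\<bar> + \<bar>v (d i) - v (c i)\<bar>)"
      using * le by (intro sum_mono) auto
    also have "\<dots> < \<epsilon>" using 1(2)[of n c d] 2(2)[of n c d] * by (simp add: sum.distrib)
    finally show "(\<Sum>i<n. \<bar>w (d i) - w (c i)\<bar>) < \<epsilon>" .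
  qed (use 1 2 in auto)
qed

text \<open>
  Partitions are initial segments of monotone sequences, and need not reach the ends of the
  interval; values in \<^typ>\<open>ennreal\<close> postpone the question of finiteness.
\<close>

definition variation :: "(real \<Rightarrow> real) \<Rightarrow> real \<Rightarrow> real \<Rightarrow> ennreal" where
  "variation u s t = (SUP (p, n) \<in> {(p, n). mono p \<and> s \<le> p 0 \<and> p n \<le> t}.
     ennreal (\<Sum>i<n. \<bar>u (p (Suc i)) - u (p i)\<bar>))"

lemma variation_upper:
  "mono p \<Longrightarrow> s \<le> p 0 \<Longrightarrow> p n \<le> t \<Longrightarrow> ennreal (\<Sum>i<n. \<bar>u (p (Suc i)) - u (p i)\<bar>) \<le> variation u s t"
  unfolding variation_def by (rule SUP_upper2[of "(p, n)"]) auto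

lemma variation_least:
  "(\<And>p n. mono p \<Longrightarrow> s \<le> p 0 \<Longrightarrow> p n \<le> t \<Longrightarrow> ennreal (\<Sum>i<n. \<bar>u (p (Suc i)) - u (p i)\<bar>) \<le> B) \<Longrightarrow>
    variation u s t \<le> B"
  unfolding variation_def by (rule SUP_least) auto

lemma increment_le_variation:
  assumes "s \<le> t"
  shows "ennreal \<bar>u t - u s\<bar> \<le> variation u s t"
proof -
  have "mono (\<lambda>i::nat. if i = 0 then s else t)" using assms by (auto simp: mono_def)
  from variation_upper[OF this, of s 1 t u] show ?thesis by simp
qed

text \<open>
  A partition of the long interval is projected to both halves by \<open>min\<close> and \<open>max\<close> with \<open>s\<close>; only the
  step across \<open>s\<close> is split by this, and there the triangle inequality applies.
\<close>

lemma variation_subadditive: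
  assumes "r \<le> s" "s \<le> t"
  shows "variation u r t \<le> variation u r s + variation u s t"
proof (rule variation_least)
  fix p :: "nat \<Rightarrow> real" and n assume p: "mono p" "r \<le> p 0" "p n \<le> t"
  have mono: "mono (\<lambda>i. min (p i) s)" "mono (\<lambda>i. max (p i) s)"
    using p(1) by (auto simp: mono_def min_def max_def) (meson order_trans)+
  let ?A = "\<Sum>i<n. \<bar>u (min (p (Suc i)) s) - u (min (p i) s)\<bar>"
  let ?B = "\<Sum>i<n. \<bar>u (max (p (Suc i)) s) - u (max (p i) s)\<bar>"
  have "(\<Sum>i<n. \<bar>u (p (Suc i)) - u (p i)\<bar>) \<le> ?A + ?B"
    unfolding sum.distrib[symmetric] by (rule sum_mono) (auto simp: min_def max_def)
  then have "ennreal (\<Sum>i<n. \<bar>u (p (Suc i)) - u (p i)\<bar>) \<le> ennreal (?A + ?B)"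
    by (rule ennreal_leI)
  also have "\<dots> = ennreal ?A + ennreal ?B"
    by (intro ennreal_plus sum_nonneg) auto
  also have "\<dots> \<le> variation u r s + variation u s t"
    using assms p by (intro add_mono variation_upper[OF mono(1)] variation_upper[OF mono(2)]) auto
  finally show "ennreal (\<Sum>i<n. \<bar>u (p (Suc i)) - u (p i)\<bar>) \<le> variation u r s + variation u s t" .
qed

text \<open>
  Partitions of the two halves are concatenated; the step from the last point of the first to the
  first point of the second can only add to the sum.
\<close>

lemma variation_superadditive:
  assumes "r \<le> s" "s \<le> t"
  shows "variation u r s + variation u s t \<le> variation u r t"
proof -
  have ne: "{(p :: nat \<Rightarrow> real, n :: nat). mono p \<and> c \<le> p 0 \<and> p n \<le> d} \<noteq> {}" if "c \<le> d" for c d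
    using that by (auto intro!: exI[of _ "\<lambda>_. c"] simp: mono_def)
  have main: "ennreal (\<Sum>i<n. \<bar>u (p (Suc i)) - u (p i)\<bar>) + ennreal (\<Sum>i<m. \<bar>u (q (Suc i)) - u (q i)\<bar>)
      \<le> variation u r t"
    if p: "mono p" "r \<le> p 0" "p n \<le> s" and q: "mono q" "s \<le> q 0" "q m \<le> t" for p q :: "nat \<Rightarrow> real" and n m
  proof -
    define w where "w i = (if i \<le> n then p i else q (i - Suc n))" for i
    have pq: "p i \<le> q j" if "i \<le> n" for i j
      using p q that monoD[OF p(1), of i n] monoD[OF q(1), of 0 j] by linarith
    have "mono w"
      unfolding w_def using p(1) q(1) pq by (auto simp: mono_def)
    moreover have "r \<le> w 0" "w (n + Suc m) \<le> t" using p q by (auto simp: w_def)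
    ultimately have upper: "ennreal (\<Sum>i<n + Suc m. \<bar>u (w (Suc i)) - u (w i)\<bar>) \<le> variation u r t"
      by (rule variation_upper)
    have "(\<Sum>i<n. \<bar>u (p (Suc i)) - u (p i)\<bar>) + (\<Sum>i<k. \<bar>u (q (Suc i)) - u (q i)\<bar>)
       \<le> (\<Sum>i<n + Suc k. \<bar>u (w (Suc i)) - u (w i)\<bar>)" for k
    proof (induction k)
      case 0
      have "(\<Sum>i<n. \<bar>u (p (Suc i)) - u (p i)\<bar>) = (\<Sum>i<n. \<bar>u (w (Suc i)) - u (w i)\<bar>)"
        by (intro sum.cong) (auto simp: w_def)
      then show ?case by simp
    next
      case (Suc k)
      then show ?case by (simp add: w_def)
    qed
    from order_trans[OF ennreal_leI[OF this] upper] show ?thesis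
      by (subst ennreal_plus[symmetric]) (auto intro!: sum_nonneg simp del: ennreal_plus)
  qed
  show ?thesis
    unfolding variation_def[of u r s] variation_def[of u s t]
    by (subst ennreal_SUP_add_left[OF ne[OF assms(1)], symmetric], rule SUP_least,
        subst ennreal_SUP_add_right[OF ne[OF assms(2)]], rule SUP_least) (auto intro!: main)
qed

text \<open>
  A sum of independent suprema is bounded once all sums of chosen terms are; the summand \<open>K\<close>
  carries the terms already treated through the induction.
\<close>

lemma add_sum_SUP_le:
  fixes f :: "'i \<Rightarrow> 'a \<Rightarrow> ennreal"
  assumes "finite I" "\<And>i. i \<in> I \<Longrightarrow> A i \<noteq> {}"
    and "\<And>x. (\<And>i. i \<in> I \<Longrightarrow> x i \<in> A i) \<Longrightarrow> K + (\<Sum>i\<in>I. f i (x i)) \<le> C"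
  shows "K + (\<Sum>i\<in>I. SUP y\<in>A i. f i y) \<le> C"
  using assms
proof (induction I arbitrary: K rule: finite_induct)
  case empty
  then show ?case by simp
next
  case (insert j I)
  have "(K + f j y) + (\<Sum>i\<in>I. SUP y\<in>A i. f i y) \<le> C" if y: "y \<in> A j" for y
  proof (rule insert.IH)
    fix x assume x: "\<And>i. i \<in> I \<Longrightarrow> x i \<in> A i"
    have "(\<Sum>i\<in>I. f i ((x(j := y)) i)) = (\<Sum>i\<in>I. f i (x i))"
      using insert(2) by (intro sum.cong) auto
    moreover have "K + (\<Sum>i\<in>insert j I. f i ((x(j := y)) i)) \<le> C"
      using x y by (intro insert.prems(2)) auto
    ultimately show "K + f j y + (\<Sum>i\<in>I. f i (x i)) \<le> C"
      using insert(1,2) by (simp add: add.assoc)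
  qed (use insert.prems in auto)
  then have "(SUP y\<in>A j. (K + (\<Sum>i\<in>I. SUP y\<in>A i. f i y)) + f j y) \<le> C"
    by (intro SUP_least) (simp add: ac_simps)
  then show ?case
    using insert by (subst (asm) ennreal_SUP_add_right[symmetric]) (auto simp: ac_simps)
qed

text \<open>
  Refining each interval of an admissible family by a partition yields another admissible family
  of no greater total length, so the bound on increments passes to variations.
\<close>

lemma abs_cont_variation_small:
  assumes u: "abs_cont a b u" and \<epsilon>: "\<epsilon> > 0"
  obtains \<delta> where "\<delta> > 0"
    "\<And>(n::nat) c d. (\<forall>i<n. a \<le> c i \<and> c i \<le> d i \<and> d i \<le> b) \<Longrightarrow>
       disjoint_family_on (\<lambda>i. {c i<..<d i}) {..<n} \<Longrightarrow> (\<Sum>i<n. d i - c i) < \<delta> \<Longrightarrow>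
       (\<Sum>i<n. variation u (c i) (d i)) \<le> ennreal \<epsilon>"
proof -
  obtain \<delta> where \<delta>: "\<delta> > 0"
    "\<And>(J :: (nat \<times> nat) set) c d. finite J \<Longrightarrow> (\<And>i. i \<in> J \<Longrightarrow> a \<le> c i \<and> c i \<le> d i \<and> d i \<le> b) \<Longrightarrow>
       disjoint_family_on (\<lambda>i. {c i<..<d i}) J \<Longrightarrow> (\<Sum>i\<in>J. d i - c i) < \<delta> \<Longrightarrow>
       (\<Sum>i\<in>J. \<bar>u (d i) - u (c i)\<bar>) < \<epsilon>"
    using abs_cont_finite_family[OF u \<epsilon>] by blast
  show ?thesis
  proof (rule that[OF \<delta>(1)])
    fix n :: nat and c d :: "nat \<Rightarrow> real"
    assume cd: "\<forall>i<n. a \<le> c i \<and> c i \<le> d i \<and> d i \<le> b"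
      and disj: "disjoint_family_on (\<lambda>i. {c i<..<d i}) {..<n}" and len: "(\<Sum>i<n. d i - c i) < \<delta>"
    have "0 + (\<Sum>i<n. variation u (c i) (d i)) \<le> ennreal \<epsilon>"
      unfolding variation_def
    proof (rule add_sum_SUP_le)
      show "{(p :: nat \<Rightarrow> real, m :: nat). mono p \<and> c i \<le> p 0 \<and> p m \<le> d i} \<noteq> {}" if "i \<in> {..<n}" for i
        using that cd by (auto intro!: exI[of _ "\<lambda>_. c i"] simp: mono_def)
      fix x assume x: "\<And>i. i \<in> {..<n} \<Longrightarrow> x i \<in> {(p :: nat \<Rightarrow> real, m :: nat). mono p \<and> c i \<le> p 0 \<and> p m \<le> d i}"
      define P where "P i = fst (x i)" for i
      define m where "m i = snd (x i)" for i
      have P: "mono (P i)" "c i \<le> P i 0" "P i (m i) \<le> d i" if "i < n" for i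
        using x[of i] that by (auto simp: P_def m_def split: prod.splits)
      have Pb: "c i \<le> P i j" "j \<le> m i \<Longrightarrow> P i j \<le> d i" if "i < n" for i j
        using P[OF that] monoD[OF P(1)[OF that], of 0 j] monoD[OF P(1)[OF that], of j "m i"] by auto
      define J where "J = (SIGMA i:{..<n}. {..<m i})"
      have "(\<Sum>ij\<in>J. \<bar>u (P (fst ij) (Suc (snd ij))) - u (P (fst ij) (snd ij))\<bar>) < \<epsilon>"
      proof (rule \<delta>(2))
        show "finite J" by (simp add: J_def)
        fix ij assume "ij \<in> J"
        then obtain i j where ij: "ij = (i, j)" "i < n" "j < m i" by (auto simp: J_def)
        show "a \<le> P (fst ij) (snd ij) \<and> P (fst ij) (snd ij) \<le> P (fst ij) (Suc (snd ij)) \<and> P (fst ij) (Suc (snd ij)) \<le> b"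
          using ij cd Pb(1)[of i j] Pb(2)[of i "Suc j"] monoD[OF P(1), of i j "Suc j"] by force
      next
        show "disjoint_family_on (\<lambda>ij. {P (fst ij) (snd ij)<..<P (fst ij) (Suc (snd ij))}) J"
          unfolding disjoint_family_on_def
        proof (intro ballI impI)
          fix k l assume "k \<in> J" "l \<in> J" and ne: "k \<noteq> l"
          then obtain i j i' j' where kl: "k = (i, j)" "l = (i', j')" "i < n" "i' < n" "j < m i" "j' < m i'"
            by (auto simp: J_def)
          show "{P (fst k) (snd k)<..<P (fst k) (Suc (snd k))} \<inter> {P (fst l) (snd l)<..<P (fst l) (Suc (snd l))} = {}"
          proof (cases "i = i'")
            case True
            then have "j < j' \<or> j' < j" using ne kl by auto
            then have "P i (Suc j) \<le> P i j' \<or> P i (Suc j') \<le> P i j"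
              using monoD[OF P(1)[OF kl(3)]] by (auto simp: Suc_le_eq)
            then show ?thesis using kl True by auto
          next
            case False
            have "{P i j<..<P i (Suc j)} \<subseteq> {c i<..<d i}" "{P i' j'<..<P i' (Suc j')} \<subseteq> {c i'<..<d i'}"
              using kl Pb(1)[of i j] Pb(2)[of i "Suc j"] Pb(1)[of i' j'] Pb(2)[of i' "Suc j'"] by force+
            moreover have "{c i<..<d i} \<inter> {c i'<..<d i'} = {}"
              using disj False kl by (auto simp: disjoint_family_on_def)
            ultimately show ?thesis unfolding kl fst_conv snd_conv by blast
          qed
        qed
        have "(\<Sum>ij\<in>J. P (fst ij) (Suc (snd ij)) - P (fst ij) (snd ij)) = (\<Sum>i<n. \<Sum>j<m i. P i (Suc j) - P i j)"
          unfolding J_def by (subst sum.Sigma) (auto simp: case_prod_beta)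
        also have "\<dots> = (\<Sum>i<n. P i (m i) - P i 0)" by (simp add: sum_lessThan_telescope)
        also have "\<dots> \<le> (\<Sum>i<n. d i - c i)" by (rule sum_mono) (use P in \<open>auto intro: diff_mono\<close>)
        finally show "(\<Sum>ij\<in>J. P (fst ij) (Suc (snd ij)) - P (fst ij) (snd ij)) < \<delta>" using len by simp
      qed
      then have "(\<Sum>i<n. \<Sum>j<m i. \<bar>u (P i (Suc j)) - u (P i j)\<bar>) < \<epsilon>"
        unfolding J_def by (subst sum.Sigma) (auto simp: case_prod_beta)
      then show "0 + (\<Sum>i<n. case x i of (p, m) \<Rightarrow> ennreal (\<Sum>j<m. \<bar>u (p (Suc j)) - u (p j)\<bar>)) \<le> ennreal \<epsilon>"
        by (simp add: P_def m_def case_prod_beta sum_nonneg ennreal_leI)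
    qed simp
    then show "(\<Sum>i<n. variation u (c i) (d i)) \<le> ennreal \<epsilon>" by simp
  qed
qed


text \<open>
  The function \<open>F\<close> is the variation from \<open>a\<close>; it is finite because \<open>[a,b]\<close> is a union of finitely
  many intervals short enough to have variation at most 1.
\<close>

lemma abs_cont_eq_diff_mono:
  assumes u: "abs_cont a b u" and ab: "a \<le> b"
  obtains F where "mono_on {a..b} F" "mono_on {a..b} (\<lambda>t. F t + u t)" "abs_cont a b F"
proof -
  obtain \<delta> where \<delta>: "\<delta> > 0"
    "\<And>(n::nat) c d. (\<forall>i<n. a \<le> c i \<and> c i \<le> d i \<and> d i \<le> b) \<Longrightarrow>
       disjoint_family_on (\<lambda>i. {c i<..<d i}) {..<n} \<Longrightarrow> (\<Sum>i<n. d i - c i) < \<delta> \<Longrightarrow>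
       (\<Sum>i<n. variation u (c i) (d i)) \<le> ennreal 1"
    using abs_cont_variation_small[OF u zero_less_one] by blast
  have small: "variation u s t \<le> 1" if "a \<le> s" "s \<le> t" "t \<le> b" "t - s < \<delta>" for s t
    using \<delta>(2)[of 1 "\<lambda>_. s" "\<lambda>_. t"] that by (simp add: disjoint_family_on_def)
  obtain N :: nat where N: "(b - a) / \<delta> < real N" using reals_Archimedean2 by blast
  define h where "h = (b - a) / real N"
  have "0 \<le> (b - a) / \<delta>" using ab \<delta> by simp
  then have N0: "real N > 0" using N by linarith
  have h: "h \<ge> 0" "h < \<delta>" "real N * h = b - a"
    using N N0 ab \<delta>(1) by (auto simp: h_def field_simps)
  have "variation u a (a + real k * h) \<le> of_nat (Suc k)" if "k \<le> N" for k
    using that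
  proof (induction k)
    case 0
    then show ?case using small[of a a] ab \<delta>(1) by simp
  next
    case (Suc k)
    have kh: "real (Suc k) * h \<le> b - a"
      using mult_right_mono[of "real (Suc k)" "real N" h] Suc(2) h by simp
    have "variation u a (a + real (Suc k) * h) \<le>
        variation u a (a + real k * h) + variation u (a + real k * h) (a + real (Suc k) * h)"
      using h(1) by (intro variation_subadditive) (auto intro: mult_right_mono)
    also have "\<dots> \<le> of_nat (Suc k) + 1"
      using h kh Suc by (intro add_mono small Suc.IH) (auto simp: algebra_simps)
    finally show ?case by (simp add: add.commute)
  qed
  from this[of N] have "variation u a b \<le> of_nat (Suc N)" by (simp add: h)
  then have fin_b: "variation u a b < \<infinity>"
    by (rule le_less_trans) (simp add: of_nat_less_top)
  have fin: "variation u s t < \<infinity>" if "a \<le> s" "s \<le> t" "t \<le> b" for s t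
  proof -
    have "variation u s t \<le> variation u a t"
      using variation_superadditive[of a s t u] that by (meson add_increasing order_refl order_trans zero_le)
    also have "\<dots> \<le> variation u a b"
      using variation_superadditive[of a t b u] that by (meson add_increasing2 order_refl order_trans zero_le)
    finally show ?thesis using fin_b by (rule le_less_trans)
  qed
  define F where "F t = enn2real (variation u a t)" for t
  have le1: "\<bar>u t - u s\<bar> \<le> F t - F s" if st: "a \<le> s" "s \<le> t" "t \<le> b" for s t
  proof -
    have "ennreal \<bar>u t - u s\<bar> \<le> variation u s t" using st by (intro increment_le_variation)
    then have "variation u a s + ennreal \<bar>u t - u s\<bar> \<le> variation u a t"
      using variation_superadditive[of a s t u] st by (meson add_left_mono order_trans)
    then have "enn2real (variation u a s + ennreal \<bar>u t - u s\<bar>) \<le> F t"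
      unfolding F_def using fin[of a t] st by (intro enn2real_mono) auto
    then show ?thesis using fin[of a s] st by (subst (asm) enn2real_plus) (auto simp: F_def)
  qed
  have le2: "F t - F s \<le> enn2real (variation u s t)" if st: "a \<le> s" "s \<le> t" "t \<le> b" for s t
  proof -
    have "F t \<le> enn2real (variation u a s + variation u s t)"
      unfolding F_def using fin[of a s] fin[of s t] st
      by (intro enn2real_mono variation_subadditive) auto
    then show ?thesis using fin[of a s] fin[of s t] st by (subst (asm) enn2real_plus) (auto simp: F_def)
  qed
  have F_mono: "F s \<le> F t" if "a \<le> s" "s \<le> t" "t \<le> b" for s t using le1[OF that] by linarith
  have ac: "abs_cont a b F"
    unfolding abs_cont_def
  proof (intro allI impI)
    fix \<epsilon> :: real assume e: "\<epsilon> > 0"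
    then have e2: "\<epsilon>/2 > 0" by simp
    obtain \<delta> where \<delta>: "\<delta> > 0"
      "\<And>(n::nat) c d. (\<forall>i<n. a \<le> c i \<and> c i \<le> d i \<and> d i \<le> b) \<Longrightarrow>
         disjoint_family_on (\<lambda>i. {c i<..<d i}) {..<n} \<Longrightarrow> (\<Sum>i<n. d i - c i) < \<delta> \<Longrightarrow>
         (\<Sum>i<n. variation u (c i) (d i)) \<le> ennreal (\<epsilon>/2)"
      using abs_cont_variation_small[OF u e2] by blast
    show "\<exists>\<delta>>0. \<forall>(n::nat) c d. (\<forall>i<n. a \<le> c i \<and> c i \<le> d i \<and> d i \<le> b) \<longrightarrow>
        disjoint_family_on (\<lambda>i. {c i<..<d i}) {..<n} \<longrightarrow>
        (\<Sum>i<n. d i - c i) < \<delta> \<longrightarrow> (\<Sum>i<n. \<bar>F (d i) - F (c i)\<bar>) < \<epsilon>"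
    proof (intro exI[of _ \<delta>] conjI allI impI)
      fix n :: nat and c d :: "nat \<Rightarrow> real"
      assume *: "\<forall>i<n. a \<le> c i \<and> c i \<le> d i \<and> d i \<le> b" "disjoint_family_on (\<lambda>i. {c i<..<d i}) {..<n}"
        "(\<Sum>i<n. d i - c i) < \<delta>"
      have "(\<Sum>i<n. \<bar>F (d i) - F (c i)\<bar>) \<le> (\<Sum>i<n. enn2real (variation u (c i) (d i)))"
        using le2 F_mono * by (intro sum_mono) (auto simp: abs_of_nonneg)
      also have "\<dots> = enn2real (\<Sum>i<n. variation u (c i) (d i))"
        using fin * by (subst enn2real_sum) auto
      also have "\<dots> \<le> \<epsilon>/2" using \<delta>(2)[OF *] e by (intro enn2real_leI) auto
      finally show "(\<Sum>i<n. \<bar>F (d i) - F (c i)\<bar>) < \<epsilon>" using e by linarith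
    qed (use \<delta> in auto)
  qed
  show ?thesis
  proof (rule that[OF _ _ ac])
    show "mono_on {a..b} F" using F_mono by (auto simp: mono_on_def)
    show "mono_on {a..b} (\<lambda>t. F t + u t)" using le1 by (force simp: mono_on_def)
  qed
qed


section \<open>Absolutely continuous functions are indefinite integrals\<close>

text \<open>
  Integrability of \<open>f\<close> on the whole line is no restriction on \<open>u\<close>, because \<open>f\<close> may be set to zero
  off the interval, and it avoids keeping track of subintervals.
\<close>

definition is_primitive :: "real \<Rightarrow> real \<Rightarrow> (real \<Rightarrow> real) \<Rightarrow> (real \<Rightarrow> real) \<Rightarrow> bool" where
  "is_primitive a b u f \<longleftrightarrow>
     integrable lebesgue f \<and> (\<forall>t\<in>{a..b}. u t = u a + (LINT s:{a..t}|lebesgue. f s))"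

lemma is_primitive_integrable [dest]: "is_primitive a b u f \<Longrightarrow> integrable lebesgue f"
  by (simp add: is_primitive_def)

lemma set_integrable_subset_lebesgue:
  fixes f :: "real \<Rightarrow> real"
  shows "integrable lebesgue f \<Longrightarrow> A \<in> sets lebesgue \<Longrightarrow> set_integrable lebesgue A f"
  unfolding set_integrable_def by (rule integrable_mult_indicator)

lemma is_primitive_diff:
  assumes "is_primitive a b u f" "is_primitive a b v g"
  shows "is_primitive a b (\<lambda>t. u t - v t) (\<lambda>t. f t - g t)"
  unfolding is_primitive_def
proof (intro conjI ballI)
  have f: "integrable lebesgue f" "integrable lebesgue g" using assms by auto
  then show "integrable lebesgue (\<lambda>t. f t - g t)" by simp
  fix t assume t: "t \<in> {a..b}"
  then have "u t = u a + (LINT s:{a..t}|lebesgue. f s)" "v t = v a + (LINT s:{a..t}|lebesgue. g s)"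
    using assms unfolding is_primitive_def by blast+
  then show "u t - v t = u a - v a + (LINT s:{a..t}|lebesgue. f s - g s)"
    using f by (subst set_integral_diff(2)) (auto intro: set_integrable_subset_lebesgue)
qed

text \<open>
  The density is the Radon-Nikodym derivative of the Stieltjes measure of \<open>F\<close>. That this measure
  vanishes on Lebesgue null sets is what absolute continuity of \<open>F\<close> says, once a null set is covered
  by nonoverlapping closed intervals of small total length.
\<close>

lemma mono_abs_cont_eq_integral:
  assumes F: "mono_on {a..b} F" and ac: "abs_cont a b F" and ab: "a \<le> b"
  obtains f where "is_primitive a b F f"
proof -
  \<comment> \<open>a Stieltjes measure needs a function on the whole line: extend by constants\<close>
  define G where "G t = F (max a (min b t))" for t
  have G_eq: "G t = F t" if "t \<in> {a..b}" for t using that by (simp add: G_def)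
  have G_mono: "G s \<le> G t" if "s \<le> t" for s t
    unfolding G_def using that ab by (intro mono_onD[OF F]) (auto simp: max_def min_def)
  have G_cont: "continuous_on UNIV G"
    unfolding G_def
    by (rule continuous_on_compose2[OF abs_cont_imp_continuous_on[OF ac]])
      (use ab in \<open>auto intro!: continuous_intros\<close>)
  define M where "M = interval_measure G"
  have Icc: "emeasure M {c..d} = ennreal (G d - G c)" if "c \<le> d" for c d
    unfolding M_def using emeasure_interval_measure_Icc[OF that G_mono G_cont] .
  have [simp]: "sets M = sets borel" by (simp add: M_def)
  have null: "emeasure M (N \<inter> {a..b}) = 0" if N: "N \<in> null_sets lborel" for N
  proof -
    have [measurable]: "N \<in> sets borel" using N by auto
    have neg: "negligible (N \<inter> {a..b})"
      using N by (intro negligible_subset[of N "N \<inter> {a..b}"])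
         (auto simp: negligible_iff_null_sets null_sets_def)
    have "emeasure M (N \<inter> {a..b}) \<le> 0 + ennreal \<epsilon>" if e: "\<epsilon> > 0" for \<epsilon>
    proof -
      obtain \<delta> where \<delta>: "\<delta> > 0"
        "\<And>(J :: real set set) c d. finite J \<Longrightarrow> (\<And>i. i \<in> J \<Longrightarrow> a \<le> c i \<and> c i \<le> d i \<and> d i \<le> b) \<Longrightarrow>
           disjoint_family_on (\<lambda>i. {c i<..<d i}) J \<Longrightarrow> (\<Sum>i\<in>J. d i - c i) < \<delta> \<Longrightarrow>
           (\<Sum>i\<in>J. \<bar>F (d i) - F (c i)\<bar>) < \<epsilon>"
        using abs_cont_finite_family[OF ac e] by blast
      have "\<delta>/2 > 0" using \<delta> by simp
      have sub: "N \<inter> {a..b} \<subseteq> cbox a b" by simp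
      have "\<exists>D. countable D \<and> (\<forall>K\<in>D. K \<subseteq> cbox a b \<and> K \<noteq> {} \<and> (\<exists>c d. K = cbox c d)) \<and>
        pairwise (\<lambda>A B. interior A \<inter> interior B = {}) D \<and> N \<inter> {a..b} \<subseteq> \<Union>D \<and> \<Union>D \<in> lmeasurable \<and>
        measure lebesgue (\<Union>D) \<le> measure lebesgue (N \<inter> {a..b}) + \<delta>/2"
      proof (rule measurable_outer_intervals_bounded[OF negligible_imp_measurable[OF neg] sub \<open>\<delta>/2 > 0\<close>])
        fix D :: "real set set"
        assume "countable D" "\<And>K. K \<in> D \<Longrightarrow> K \<subseteq> cbox a b \<and> K \<noteq> {} \<and> (\<exists>c d. K = cbox c d)"
          "pairwise (\<lambda>A B. interior A \<inter> interior B = {}) D" "N \<inter> {a..b} \<subseteq> \<Union>D" "\<Union>D \<in> lmeasurable"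
          "measure lebesgue (\<Union>D) \<le> measure lebesgue (N \<inter> {a..b}) + \<delta>/2"
        then show ?thesis by (intro exI[of _ D] conjI ballI) (assumption | blast)+
      qed
      then obtain D where D: "countable D"
        "\<And>K. K \<in> D \<Longrightarrow> K \<subseteq> cbox a b \<and> K \<noteq> {} \<and> (\<exists>c d. K = cbox c d)"
        "pairwise (\<lambda>A B. interior A \<inter> interior B = {}) D" 
        "N \<inter> {a..b} \<subseteq> \<Union>D" "\<Union>D \<in> lmeasurable"
        "measure lebesgue (\<Union>D) \<le> measure lebesgue (N \<inter> {a..b}) + \<delta>/2"
        by (elim exE conjE) blast
      have K: "K = {Inf K..Sup K} \<and> a \<le> Inf K \<and> Inf K \<le> Sup K \<and> Sup K \<le> b" if KD: "K \<in> D" for K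
      proof -
        obtain c d where cd: "K = {c..d}" using D(2)[OF KD] by auto
        moreover have "c \<le> d" "a \<le> c" "d \<le> b" using D(2)[OF KD] cd by auto
        ultimately show ?thesis by simp
      qed
      have Kle: "Inf K \<le> Sup K" if "K \<in> D" for K using K[OF that] by blast
      have Kint: "interior K = {Inf K<..<Sup K}" if "K \<in> D" for K
        using K[OF that] interior_atLeastAtMost_real[of "Inf K" "Sup K"] by simp
      have mK: "K \<in> fmeasurable M" if "K \<in> D" for K
      proof -
        have "{c..d} \<in> fmeasurable M" if "c \<le> d" for c d
          using that by (intro fmeasurableI) (auto simp: Icc)
        from this[of "Inf K" "Sup K"] show ?thesis using K[OF that] by simp
      qed
      have "\<Union>D \<in> fmeasurable M \<and> measure M (\<Union>D) \<le> \<epsilon>"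
      proof -
        have bound: "measure M (\<Union>K\<in>J. K) \<le> \<epsilon>" if J: "J \<subseteq> D" "finite J" for J
        proof -
          have "(\<Sum>K\<in>J. \<bar>F (Sup K) - F (Inf K)\<bar>) < \<epsilon>"
          proof (rule \<delta>(2))
            show disj: "disjoint_family_on (\<lambda>K. {Inf K<..<Sup K}) J"
              unfolding disjoint_family_on_def
            proof (intro ballI impI)
              fix K L assume "K \<in> J" "L \<in> J" "K \<noteq> L"
              then show "{Inf K<..<Sup K} \<inter> {Inf L<..<Sup L} = {}"
                using D(3) J Kint unfolding pairwise_def by (metis subsetD)
            qed
            have "(\<Sum>K\<in>J. Sup K - Inf K) = (\<Sum>K\<in>J. measure lebesgue {Inf K<..<Sup K})"
              using Kle J by (intro sum.cong) (auto simp: subset_iff)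
            also have "\<dots> = measure lebesgue (\<Union>K\<in>J. {Inf K<..<Sup K})"
              using J disj Kle by (intro measure_finite_Union[symmetric]) (auto simp: image_subset_iff subset_iff)
            also have "\<dots> \<le> measure lebesgue (\<Union>D)"
            proof (rule measure_mono_fmeasurable)
              have "{Inf K<..<Sup K} \<subseteq> K" if "K \<in> D" for K
                using K[OF that] greaterThanLessThan_subseteq_atLeastAtMost_iff by blast
              then show "(\<Union>K\<in>J. {Inf K<..<Sup K}) \<subseteq> \<Union>D" using J by blast
            qed (use J D(5) in auto)
            also have "\<dots> < \<delta>" using D(6) negligible_imp_measure0[OF neg] \<delta>(1) by simp
            finally show "(\<Sum>K\<in>J. Sup K - Inf K) < \<delta>" .
          qed (use J K in auto)
          moreover have "measure M (\<Union>K\<in>J. K) \<le> (\<Sum>K\<in>J. measure M K)"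
            using J fmeasurableD[OF mK] by (intro measure_UNION_le) auto
          moreover have "measure M K = \<bar>F (Sup K) - F (Inf K)\<bar>" if "K \<in> J" for K
          proof -
            have KD: "K \<in> D" using that J by auto
            have "emeasure M K = ennreal (G (Sup K) - G (Inf K))"
              using Icc[OF Kle[OF KD]] K[OF KD] by simp
            then have "measure M K = G (Sup K) - G (Inf K)"
              using G_mono[OF Kle[OF KD]] by (simp add: measure_def)
            also have "\<dots> = \<bar>F (Sup K) - F (Inf K)\<bar>"
              using K[OF KD] G_mono[of "Inf K" "Sup K"] G_eq[of "Inf K"] G_eq[of "Sup K"] by simp
            finally show ?thesis .
          qed
          ultimately show ?thesis by simp
        qed
        show ?thesis
          using fmeasurable_UN_bound[OF D(1), of "\<lambda>K. K" M \<epsilon>] measure_UN_bound[OF D(1), of "\<lambda>K. K" M \<epsilon>]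
            mK bound by auto
      qed
      then have "emeasure M (\<Union>D) \<le> ennreal \<epsilon>" by (simp add: emeasure_eq_measure2 ennreal_leI)
      moreover have "emeasure M (N \<inter> {a..b}) \<le> emeasure M (\<Union>D)"
        using D(4) \<open>\<Union>D \<in> fmeasurable M \<and> _\<close> by (intro emeasure_mono) auto
      ultimately show ?thesis by simp
    qed
    then have "emeasure M (N \<inter> {a..b}) \<le> 0" by (rule ennreal_le_epsilon) 
    then show ?thesis by simp
  qed
  \<comment> \<open>null sets are covered by intervals inside \<open>[a,b]\<close>, so only that part of the Stieltjes measure is kept\<close>
  define M' where "M' = density M (indicator {a..b})"
  have M'_eq: "emeasure M' A = emeasure M (A \<inter> {a..b})" if "A \<in> sets borel" for A
    using that by (simp add: M'_def emeasure_restricted Int_commute)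
  have ac': "absolutely_continuous lborel M'"
    unfolding absolutely_continuous_def using null
    by (auto simp: null_sets_def M'_eq) (simp_all add: M'_def)
  obtain g where g: "g \<in> borel_measurable lborel" "density lborel g = M'"
    using sigma_finite_measure.Radon_Nikodym[OF sigma_finite_lborel ac'] by (auto simp: M'_def)
  have g_int: "(\<integral>\<^sup>+x. g x * indicator A x \<partial>lborel) = emeasure M (A \<inter> {a..b})" if "A \<in> sets borel" for A
    using emeasure_density[OF g(1), of A] that by (simp add: g(2) M'_eq)
  have "(\<integral>\<^sup>+x. g x \<partial>lborel) < \<infinity>"
    using g_int[of UNIV] Icc[OF ab] by simp
  then have gfin: "AE x in lborel. g x \<noteq> \<infinity>" using g(1) by (intro nn_integral_PInf_AE) auto
  define f where "f x = enn2real (g x)" for x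
  have [measurable]: "g \<in> borel_measurable borel" using g(1) by simp
  have [measurable]: "f \<in> borel_measurable borel" unfolding f_def by measurable
  have fg: "AE x in lborel. ennreal (f x) = g x"
    using gfin by eventually_elim (auto simp: f_def top.not_eq_extremum)
  have "(\<integral>\<^sup>+x. ennreal (norm (f x)) \<partial>lborel) = (\<integral>\<^sup>+x. g x \<partial>lborel)"
    using fg by (intro nn_integral_cong_AE) (auto simp: f_def)
  then have f_int: "integrable lborel f" using \<open>(\<integral>\<^sup>+x. g x \<partial>lborel) < \<infinity>\<close> by (intro integrableI_bounded) auto
  have "is_primitive a b F f"
    unfolding is_primitive_def
  proof (intro conjI ballI)
    show "integrable lebesgue f" using f_int by (simp add: integrable_completion)
    fix t assume t: "t \<in> {a..b}"
    have "(LINT s:{a..t}|lebesgue. f s) = (\<integral>s. indicator {a..t} s * f s \<partial>lborel)"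
      unfolding set_lebesgue_integral_def by (subst integral_completion) auto
    also have "\<dots> = enn2real (\<integral>\<^sup>+s. ennreal (indicator {a..t} s * f s) \<partial>lborel)"
      by (intro integral_eq_nn_integral) (auto simp: f_def)
    also have "(\<integral>\<^sup>+s. ennreal (indicator {a..t} s * f s) \<partial>lborel) = (\<integral>\<^sup>+s. g s * indicator {a..t} s \<partial>lborel)"
      using fg by (intro nn_integral_cong_AE) (auto simp: indicator_def)
    also have "\<dots> = emeasure M {a..t}"
    proof -
      have "{a..t} \<inter> {a..b} = {a..t}" using t by auto
      then show ?thesis using g_int[of "{a..t}"] by (simp only: sets.top borel_closed closed_atLeastAtMost)
    qed
    also have "enn2real \<dots> = F t - F a"
      using t Icc[of a t] G_mono[of a t] G_eq[of t] G_eq[of a] ab by simp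
    finally show "F t = F a + (LINT s:{a..t}|lebesgue. f s)" by simp
  qed
  then show ?thesis by (rule that)
qed

text \<open>
  The fundamental theorem of calculus for absolutely continuous functions; the general case follows
  from the monotone one by writing \<open>u = (F + u) - F\<close>.
\<close>

theorem abs_cont_eq_integral:
  assumes u: "abs_cont a b u" and ab: "a \<le> b"
  obtains f where "is_primitive a b u f"
proof -
  obtain F where F: "mono_on {a..b} F" "mono_on {a..b} (\<lambda>t. F t + u t)" "abs_cont a b F"
    using abs_cont_eq_diff_mono[OF u ab] .
  have "abs_cont a b (\<lambda>t. F t + u t)"
    by (rule abs_cont_combine[OF F(3) u]) linarith
  then obtain f where f: "is_primitive a b (\<lambda>t. F t + u t) f"
    using mono_abs_cont_eq_integral[OF F(2) _ ab] by blast
  obtain g where g: "is_primitive a b F g"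
    using mono_abs_cont_eq_integral[OF F(1,3) ab] .
  have "is_primitive a b u (\<lambda>t. f t - g t)"
    using is_primitive_diff[OF f g] by simp
  then show ?thesis by (rule that)
qed


section \<open>The metric of the space of absolutely continuous functions\<close>

lemma set_integral_Icc_combine:
  fixes f :: "real \<Rightarrow> real"
  assumes f: "integrable lebesgue f" and "a \<le> c" "c \<le> d"
  shows "(LINT s:{a..d}|lebesgue. f s) = (LINT s:{a..c}|lebesgue. f s) + (LINT s:{c..d}|lebesgue. f s)"
proof -
  have "{a..d} = {a..c} \<union> {c..d}" using assms by auto
  moreover have "AE s in lebesgue. s \<noteq> c" by (rule AE_completion[OF AE_lborel_singleton])
  then have "AE s in lebesgue. \<not> (s \<in> {a..c} \<and> s \<in> {c..d})" by eventually_elim auto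
  ultimately show ?thesis
    using f by (simp only:) (intro set_integral_Un_AE set_integrable_subset_lebesgue; simp)
qed

lemma is_primitive_increment:
  assumes "is_primitive a b u f" "a \<le> c" "c \<le> d" "d \<le> b"
  shows "u d - u c = (LINT s:{c..d}|lebesgue. f s)"
proof -
  have "c \<in> {a..b}" "d \<in> {a..b}" using assms by auto
  then have "u c = u a + (LINT s:{a..c}|lebesgue. f s)" "u d = u a + (LINT s:{a..d}|lebesgue. f s)"
    using assms(1) unfolding is_primitive_def by blast+
  then show ?thesis using set_integral_Icc_combine[of f a c d] assms by auto
qed

text \<open>
  The difference quotients of \<open>u\<close> at \<open>t\<close> are averages of \<open>f\<close> over intervals with \<open>t\<close> as an end point.
\<close>

lemma is_primitive_AE_deriv:
  assumes u: "is_primitive a b u f"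
  shows "AE t in lebesgue. t \<in> {a<..<b} \<longrightarrow> (u has_real_derivative f t) (at t)"
  using lebesgue_differentiation[OF is_primitive_integrable[OF u]]
proof eventually_elim
  case (elim t)
  show ?case
  proof
    assume t: "t \<in> {a<..<b}"
    show "(u has_real_derivative f t) (at t)"
      unfolding has_field_derivative_iff LIM_eq
    proof (intro allI impI)
      fix e :: real assume "0 < e"
      then have e: "e/2 > 0" by simp
      obtain \<delta> where \<delta>: "\<delta> > 0" "\<And>c d. c < d \<Longrightarrow> c \<le> t \<Longrightarrow> t \<le> d \<Longrightarrow> d - c < \<delta> \<Longrightarrow>
           \<bar>(LINT s:{c..d}|lebesgue. f s) - f t * (d - c)\<bar> \<le> e/2 * (d - c)"
        using elim e by blast
      show "\<exists>s>0. \<forall>y. y \<noteq> t \<and> norm (y - t) < s \<longrightarrow> norm ((u y - u t) / (y - t) - f t) < e"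
      proof (intro exI[of _ "min \<delta> (min (t - a) (b - t))"] conjI allI impI)
        fix y assume y: "y \<noteq> t \<and> norm (y - t) < min \<delta> (min (t - a) (b - t))"
        define c where "c = min y t"
        define d where "d = max y t"
        have cd: "c < d" "c \<le> t" "t \<le> d" "d - c < \<delta>" "a \<le> c" "d \<le> b"
          using y by (auto simp: c_def d_def min_def max_def abs_if split: if_splits)
        have "\<bar>(u d - u c) - f t * (d - c)\<bar> \<le> e/2 * (d - c)"
          using \<delta>(2)[of c d] is_primitive_increment[OF u, of c d] cd by simp
        moreover have "(u d - u c) - f t * (d - c) = ((u d - u c) / (d - c) - f t) * (d - c)"
          using cd by (simp add: field_simps)
        ultimately have "\<bar>(u d - u c) / (d - c) - f t\<bar> * (d - c) \<le> e/2 * (d - c)"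
          using cd by (simp add: abs_mult)
        then have "\<bar>(u d - u c) / (d - c) - f t\<bar> \<le> e/2" using cd by simp
        moreover have "(u d - u c) / (d - c) = (u y - u t) / (y - t)"
          using minus_divide_divide[of "u t - u y" "t - y"]
          by (cases "y \<le> t") (auto simp: c_def d_def min_def max_def)
        ultimately show "norm ((u y - u t) / (y - t) - f t) < e" using \<open>0 < e\<close> by simp
      qed (use \<delta> t in auto)
    qed
  qed
qed

text \<open>
  The derivative agrees with the density almost everywhere; since Lebesgue measure is complete, this
  also makes the derivative measurable.
\<close>

lemma AC_norm_primitive:
  assumes u: "is_primitive a b u f"
  shows "AC_norm a b u = \<bar>u a\<bar> + (LINT t:{a..b}|lebesgue. \<bar>f t\<bar>)"
proof -
  have ends: "AE t in lebesgue. t \<noteq> a" "AE t in lebesgue. t \<noteq> b"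
    by (rule AE_completion[OF AE_lborel_singleton])+
  have ae: "AE t in lebesgue. indicator {a..b} t *\<^sub>R \<bar>f t\<bar> = indicator {a..b} t *\<^sub>R \<bar>deriv u t\<bar>"
    using is_primitive_AE_deriv[OF u] ends
    by eventually_elim (auto simp: indicator_def DERIV_imp_deriv)
  have m: "(\<lambda>t. indicat_real {a..b} t *\<^sub>R \<bar>f t\<bar>) \<in> borel_measurable lebesgue"
    using set_integrable_abs[OF set_integrable_subset_lebesgue[OF is_primitive_integrable[OF u], of "{a..b}"]]
    by (auto simp: set_integrable_def)
  have "(LINT t:{a..b}|lebesgue. \<bar>f t\<bar>) = (LINT t:{a..b}|lebesgue. \<bar>deriv u t\<bar>)"
    unfolding set_lebesgue_integral_def
    by (rule integral_cong_AE[OF m borel_measurable_AE[OF m ae] ae])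
  then show ?thesis by (simp add: AC_norm_def)
qed

lemma AC_norm_diff_primitive:
  assumes "is_primitive a b u f" "is_primitive a b v g"
  shows "AC_norm a b (\<lambda>t. u t - v t) = \<bar>u a - v a\<bar> + (LINT t:{a..b}|lebesgue. \<bar>f t - g t\<bar>)"
  using AC_norm_primitive[OF is_primitive_diff[OF assms]] .

lemma AC_imp_is_primitive:
  assumes "u \<in> AC a b" "a \<le> b"
  obtains f where "is_primitive a b u f"
  using abs_cont_eq_integral[of a b u] assms by (auto simp: AC_def)

text \<open>
  At points without a derivative, \<^const>\<open>deriv\<close> has an unspecified value, which is the same on
  both sides. Hence the distance is symmetric for arbitrary functions, as \<^locale>\<open>Metric_space\<close>
  demands.
\<close>

lemma abs_deriv_minus_commute:
  fixes u v :: "real \<Rightarrow> real"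
  shows "\<bar>deriv (\<lambda>t. u t - v t) x\<bar> = \<bar>deriv (\<lambda>t. v t - u t) x\<bar>"
proof (cases "\<exists>D. ((\<lambda>t. u t - v t) has_real_derivative D) (at x)")
  case True
  then obtain D where D: "((\<lambda>t. u t - v t) has_real_derivative D) (at x)" by blast
  have "((\<lambda>t. v t - u t) has_real_derivative - D) (at x)"
    using DERIV_minus[OF D] by simp
  then show ?thesis using DERIV_imp_deriv[OF D] by (simp add: DERIV_imp_deriv)
next
  case False
  have "\<nexists>D. ((\<lambda>t. v t - u t) has_real_derivative D) (at x)"
  proof
    assume "\<exists>D. ((\<lambda>t. v t - u t) has_real_derivative D) (at x)"
    then obtain D where "((\<lambda>t. v t - u t) has_real_derivative D) (at x)" by blast
    from DERIV_minus[OF this] have "((\<lambda>t. u t - v t) has_real_derivative - D) (at x)" by simp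
    with False show False by blast
  qed
  with False have "(\<lambda>D. ((\<lambda>t. u t - v t) has_real_derivative D) (at x)) =
      (\<lambda>D. ((\<lambda>t. v t - u t) has_real_derivative D) (at x))" by blast
  then show ?thesis unfolding deriv_def by (simp only:)
qed

text \<open>
  By the representation of absolutely continuous functions by densities, the distance of \<open>u\<close> and \<open>v\<close>
  is \<open>\<bar>u a - v a\<bar>\<close> plus the \<open>L\<^sup>1\<close> distance of the densities.
\<close>

theorem Metric_space_AC:
  assumes ab: "a \<le> b"
  shows "Metric_space (AC a b) (\<lambda>u v. AC_norm a b (\<lambda>t. u t - v t))"
proof
  fix u v w :: "real \<Rightarrow> real"
  show "0 \<le> AC_norm a b (\<lambda>t. u t - v t)"
    unfolding AC_norm_def set_lebesgue_integral_def by (intro add_nonneg_nonneg Bochner_Integration.integral_nonneg) auto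
  show "AC_norm a b (\<lambda>t. u t - v t) = AC_norm a b (\<lambda>t. v t - u t)"
    by (simp add: AC_norm_def abs_deriv_minus_commute[of u v] abs_minus_commute[of "u a" "v a"])
  assume u: "u \<in> AC a b" and v: "v \<in> AC a b"
  obtain f where f: "is_primitive a b u f" using AC_imp_is_primitive[OF u ab] .
  obtain g where g: "is_primitive a b v g" using AC_imp_is_primitive[OF v ab] .
  have si: "set_integrable lebesgue {c..d} (\<lambda>t. h1 t - h2 t)"
    if "is_primitive a b u1 h1" "is_primitive a b u2 h2" for u1 u2 h1 h2 c d
    using is_primitive_diff[OF that] by (intro set_integrable_subset_lebesgue) auto
  show "AC_norm a b (\<lambda>t. u t - v t) = 0 \<longleftrightarrow> u = v"
  proof
    assume "AC_norm a b (\<lambda>t. u t - v t) = 0"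
    moreover have "0 \<le> (LINT t:{a..b}|lebesgue. \<bar>f t - g t\<bar>)"
      unfolding set_lebesgue_integral_def by (intro Bochner_Integration.integral_nonneg) auto
    ultimately have 0: "u a = v a" "(LINT t:{a..b}|lebesgue. \<bar>f t - g t\<bar>) = 0"
      by (auto simp: AC_norm_diff_primitive[OF f g])
    have "u t = v t" if t: "t \<in> {a..b}" for t
    proof -
      have "u t - v t = (LINT s:{a..t}|lebesgue. f s - g s)"
        using is_primitive_increment[OF is_primitive_diff[OF f g], of a t] t 0 by simp
      also have "\<bar>\<dots>\<bar> \<le> (LINT s:{a..t}|lebesgue. \<bar>f s - g s\<bar>)"
        using set_integral_norm_bound[OF si[OF f g]] by simp
      also have "\<dots> \<le> (LINT s:{a..b}|lebesgue. \<bar>f s - g s\<bar>)"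
        unfolding set_lebesgue_integral_def
      proof (rule integral_mono)
        show "integrable lebesgue (\<lambda>s. indicat_real {c..d} s *\<^sub>R \<bar>f s - g s\<bar>)" for c d
          using set_integrable_abs[OF si[OF f g]] by (simp add: set_integrable_def)
        then show "integrable lebesgue (\<lambda>s. indicat_real {a..b} s *\<^sub>R \<bar>f s - g s\<bar>)" .
      qed (use t in \<open>auto simp: indicator_def\<close>)
      finally show ?thesis using 0 by simp
    qed
    moreover have "u \<in> extensional {a..b}" "v \<in> extensional {a..b}" using u v by (simp_all add: AC_def)
    ultimately show "u = v" by (metis extensionalityI)
  next
    assume "u = v"
    then show "AC_norm a b (\<lambda>t. u t - v t) = 0" by (simp add: AC_norm_def)
  qed
  assume w: "w \<in> AC a b"
  obtain h where h: "is_primitive a b w h" using AC_imp_is_primitive[OF w ab] .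
  note A = set_integrable_abs[OF si[OF f g]] set_integrable_abs[OF si[OF g h]] set_integrable_abs[OF si[OF f h]]
  have "(LINT t:{a..b}|lebesgue. \<bar>f t - h t\<bar>) \<le> (LINT t:{a..b}|lebesgue. \<bar>f t - g t\<bar> + \<bar>g t - h t\<bar>)"
    by (rule set_integral_mono[OF A(3) set_integral_add(1)[OF A(1,2)]]) linarith
  also have "\<dots> = (LINT t:{a..b}|lebesgue. \<bar>f t - g t\<bar>) + (LINT t:{a..b}|lebesgue. \<bar>g t - h t\<bar>)"
    by (rule set_integral_add(2)[OF A(1,2)])
  finally show "AC_norm a b (\<lambda>t. u t - w t) \<le> AC_norm a b (\<lambda>t. u t - v t) + AC_norm a b (\<lambda>t. v t - w t)"
    unfolding AC_norm_diff_primitive[OF f g] AC_norm_diff_primitive[OF f h] AC_norm_diff_primitive[OF g h]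
    by linarith
qed


section \<open>Approximation by step functions on uniform partitions\<close>

definition cell :: "real \<Rightarrow> nat \<Rightarrow> nat \<Rightarrow> real set" where
  "cell T n i = {T * real i / real n ..< T * real (Suc i) / real n}"

definition step_fun :: "real \<Rightarrow> nat \<Rightarrow> (nat \<Rightarrow> real) \<Rightarrow> real \<Rightarrow> real" where
  "step_fun T n c t = (\<Sum>i<n. c i * indicator (cell T n i) t)"

lemma cell_disjoint:
  assumes "T > 0" "t \<in> cell T n i" "t \<in> cell T n j"
  shows "i = j"
proof (rule ccontr)
  have *: False if "i < j" "t < T * real (Suc i) / real n" "T * real j / real n \<le> t" for i j
  proof -
    have "T * real (Suc i) / real n \<le> T * real j / real n"
      using that(1) assms(1) by (intro divide_right_mono mult_left_mono) auto
    then show False using that by linarith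
  qed
  assume "i \<noteq> j"
  then show False using *[of i j] *[of j i] assms by (auto simp: cell_def neq_iff)
qed

lemma step_fun_cell:
  assumes "T > 0" "t \<in> cell T n k" "k < n"
  shows "step_fun T n c t = c k"
proof -
  have "step_fun T n c t = (\<Sum>i<n. if i = k then c k else 0)"
    unfolding step_fun_def using assms cell_disjoint[of T t n] by (intro sum.cong) (auto simp: indicator_def)
  then show ?thesis using assms by simp
qed

lemma ex_cell:
  assumes "T > 0" "n > 0" "0 \<le> t" "t < T"
  obtains k where "k < n" "t \<in> cell T n k"
proof
  define k where "k = nat \<lfloor>t * real n / T\<rfloor>"
  have 0: "0 \<le> t * real n / T" using assms by simp
  have k: "real k \<le> t * real n / T" "t * real n / T < real k + 1"
    unfolding k_def using 0 by (simp, linarith)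
  have "t * real n / T < real n" using assms by (simp add: field_simps)
  with k show "k < n" by linarith
  show "t \<in> cell T n k"
    using k assms by (simp add: cell_def field_simps)
qed

lemma cell_subset:
  assumes "T > 0" "k < n"
  shows "cell T n k \<subseteq> {0..<T}"
proof -
  have "T * real (Suc k) / real n \<le> T * real n / real n"
    using assms by (intro divide_right_mono mult_left_mono) auto
  moreover have "0 \<le> T * real k / real n" using assms by simp
  ultimately show ?thesis using assms unfolding cell_def by auto
qed

lemma step_fun_outside: "T > 0 \<Longrightarrow> t \<notin> {0..<T} \<Longrightarrow> step_fun T n c t = 0"
  unfolding step_fun_def using cell_subset[of T _ n] by (fastforce intro!: sum.neutral simp: indicator_def)

text \<open>
  Step functions on the same partition can be computed with cell by cell; \<open>F 0 0 = 0\<close> accounts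
  for points off the cells, where all of them vanish.
\<close>

lemma step_fun_combine:
  assumes T: "T > 0" and F: "F 0 0 = 0"
  shows "F (step_fun T n c t) (step_fun T n d t) = step_fun T n (\<lambda>i. F (c i) (d i)) t"
proof (cases "n > 0 \<and> t \<in> {0..<T}")
  case True
  then obtain k where "k < n" "t \<in> cell T n k" using ex_cell[OF T, of n t] by auto
  then show ?thesis by (simp add: step_fun_cell[OF T])
next
  case False
  then have "step_fun T n c t = 0" for c
    using step_fun_outside[OF T, of t n] by (auto simp: step_fun_def)
  then show ?thesis using F by simp
qed

lemma step_fun_integral:
  assumes T: "T > 0"
  shows "integrable lebesgue (step_fun T n c)"
    and "(\<integral>t. step_fun T n c t \<partial>lebesgue) = (\<Sum>i<n. c i * (T / real n))"
proof -
  have le: "T * real i / real n \<le> T * real (Suc i) / real n" for i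
    using T by (intro divide_right_mono mult_left_mono) auto
  have m: "measure lebesgue (cell T n i) = T / real n" for i
    using le[of i] unfolding cell_def by (simp add: field_simps flip: diff_divide_distrib)
  have i: "integrable lebesgue (indicat_real (cell T n i))" for i
    using le[of i] by (intro integrable_real_indicator) (auto simp: cell_def)
  show "integrable lebesgue (step_fun T n c)"
    unfolding step_fun_def using i by (intro Bochner_Integration.integrable_sum integrable_mult_right)
  show "(\<integral>t. step_fun T n c t \<partial>lebesgue) = (\<Sum>i<n. c i * (T / real n))"
    unfolding step_fun_def using i by (subst Bochner_Integration.integral_sum) (auto simp: m)
qed

lemma step_fun_abs_integral:
  assumes T: "T > 0"
  shows "(LINT t:{0..T}|lebesgue. \<bar>step_fun T n c t\<bar>) = (\<Sum>i<n. \<bar>c i\<bar> * (T / real n))"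
proof -
  have "indicat_real {0..T} t *\<^sub>R \<bar>step_fun T n c t\<bar> = step_fun T n (\<lambda>i. \<bar>c i\<bar>) t" for t
    using step_fun_combine[OF T, of "\<lambda>x y. \<bar>x\<bar>" n c t c] step_fun_outside[OF T, of t n]
    by (cases "t \<in> {0..<T}") (auto simp: indicator_def)
  then show ?thesis
    unfolding set_lebesgue_integral_def using step_fun_integral(2)[OF T, of n "\<lambda>i. \<bar>c i\<bar>"] by simp
qed

lemma step_fun_bounded: "\<bar>step_fun T n c t\<bar> \<le> (\<Sum>i<n. \<bar>c i\<bar>)"
  unfolding step_fun_def
  by (rule order_trans[OF sum_abs], rule sum_mono) (auto simp: indicator_def)

definition slope :: "real \<Rightarrow> (real \<Rightarrow> real) \<Rightarrow> nat \<Rightarrow> nat \<Rightarrow> real" where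
  "slope T u n i = (u (T * real (Suc i) / real n) - u (T * real i / real n)) / (T / real n)"

lemma is_primitive_lipschitz:
  assumes u: "is_primitive a b u f" and C: "\<And>t. \<bar>f t\<bar> \<le> C" and cd: "a \<le> c" "c \<le> d" "d \<le> b"
  shows "\<bar>u d - u c\<bar> \<le> C * (d - c)"
proof -
  have si: "set_integrable lebesgue {c..d} f"
    using u by (intro set_integrable_subset_lebesgue) auto
  have "\<bar>u d - u c\<bar> \<le> (LINT t:{c..d}|lebesgue. \<bar>f t\<bar>)"
    using is_primitive_increment[OF u cd] set_integral_norm_bound[OF si] by simp
  also have "\<dots> \<le> (LINT t:{c..d}|lebesgue. C)"
  proof (rule set_integral_mono[OF set_integrable_abs[OF si] _ C])
    have "integrable lebesgue (indicat_real {c..d})"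
      by (intro integrable_real_indicator) (auto simp: emeasure_lborel_Icc_eq)
    then show "set_integrable lebesgue {c..d} (\<lambda>_. C)" by (simp add: set_integrable_def)
  qed
  also have "\<dots> = C * (d - c)" using cd by (simp add: set_lebesgue_integral_def)
  finally show ?thesis .
qed

lemma set_integral_lebesgue_point:
  fixes f :: "real \<Rightarrow> real"
  shows "(LINT s:{a..a}|lebesgue. f s) = 0"
proof -
  have "AE s in lebesgue. s \<noteq> a" by (rule AE_completion[OF AE_lborel_singleton])
  then show ?thesis
    unfolding set_lebesgue_integral_def
    by (intro integral_eq_zero_AE) (auto elim!: eventually_mono)
qed

lemma is_primitive_indefinite_integral:
  fixes f :: "real \<Rightarrow> real"
  assumes f: "integrable lebesgue f" and ab: "a \<le> b"
  shows "is_primitive a b (\<lambda>t\<in>{a..b}. c + (LINT s:{a..t}|lebesgue. f s)) f"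
  using f ab set_integral_lebesgue_point[of a f] by (auto simp: is_primitive_def)

text \<open>
  A function with bounded density is Lipschitz continuous.
\<close>

lemma is_primitive_bounded_imp_AC:
  assumes u: "is_primitive a b u f" and C: "\<And>t. \<bar>f t\<bar> \<le> C" and ext: "u \<in> extensional {a..b}"
  shows "u \<in> AC a b"
  unfolding AC_def
proof (intro CollectI conjI ext, unfold abs_cont_def, intro allI impI)
  fix \<epsilon> :: real assume e: "\<epsilon> > 0"
  have C0: "C \<ge> 0" using C[of 0] by linarith
  show "\<exists>\<delta>>0. \<forall>(n::nat) c d. (\<forall>i<n. a \<le> c i \<and> c i \<le> d i \<and> d i \<le> b) \<longrightarrow>
        disjoint_family_on (\<lambda>i. {c i<..<d i}) {..<n} \<longrightarrow>
        (\<Sum>i<n. d i - c i) < \<delta> \<longrightarrow> (\<Sum>i<n. \<bar>u (d i) - u (c i)\<bar>) < \<epsilon>"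
  proof (intro exI[of _ "\<epsilon> / (C + 1)"] conjI allI impI)
    show "\<epsilon> / (C + 1) > 0" using e C0 by simp
    fix n :: nat and c d :: "nat \<Rightarrow> real"
    assume *: "\<forall>i<n. a \<le> c i \<and> c i \<le> d i \<and> d i \<le> b" "(\<Sum>i<n. d i - c i) < \<epsilon> / (C + 1)"
    have "(\<Sum>i<n. \<bar>u (d i) - u (c i)\<bar>) \<le> (\<Sum>i<n. (C + 1) * (d i - c i))"
    proof (rule sum_mono)
      fix i assume "i \<in> {..<n}"
      then have cd: "a \<le> c i" "c i \<le> d i" "d i \<le> b" using * by auto
      have "\<bar>u (d i) - u (c i)\<bar> \<le> C * (d i - c i)" by (rule is_primitive_lipschitz[OF u C cd])
      also have "\<dots> \<le> (C + 1) * (d i - c i)" using cd by (intro mult_right_mono) auto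
      finally show "\<bar>u (d i) - u (c i)\<bar> \<le> (C + 1) * (d i - c i)" .
    qed
    also have "\<dots> = (C + 1) * (\<Sum>i<n. d i - c i)" by (simp add: sum_distrib_left)
    also have "\<dots> < \<epsilon>" using *(2) C0 by (simp add: pos_less_divide_eq mult.commute)
    finally show "(\<Sum>i<n. \<bar>u (d i) - u (c i)\<bar>) < \<epsilon>" .
  qed
qed

text \<open>
  The value of the step function at \<open>t\<close> is the average of \<open>f\<close> over the cell that contains \<open>t\<close>. These
  averages converge to \<open>f t\<close> almost everywhere by Lebesgue's differentiation theorem and share the
  bound \<open>C\<close> of \<open>f\<close>, so dominated convergence applies.
\<close>

lemma averages_tendsto_L1:
  assumes T: "T > 0" and u: "is_primitive 0 T u f" and C: "\<And>t. \<bar>f t\<bar> \<le> C"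
  shows "(\<lambda>n. LINT t:{0..T}|lebesgue. \<bar>f t - step_fun T n (slope T u n) t\<bar>) \<longlonglongrightarrow> 0"
proof -
  have C0: "C \<ge> 0" using C[of 0] by linarith
  have nodes: "0 \<le> T * real k / real n" "T * real k / real n < T * real (Suc k) / real n"
    "T * real (Suc k) / real n \<le> T" "T * real (Suc k) / real n - T * real k / real n = T / real n"
    if "k < n" for k n
  proof -
    show "0 \<le> T * real k / real n" using T by simp
    show "T * real k / real n < T * real (Suc k) / real n"
      using T that by (intro divide_strict_right_mono mult_strict_left_mono) auto
    have "T * real (Suc k) / real n \<le> T * real n / real n"
      using T that by (intro divide_right_mono mult_left_mono) auto
    then show "T * real (Suc k) / real n \<le> T" using that by simp
    show "T * real (Suc k) / real n - T * real k / real n = T / real n"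
      by (simp add: algebra_simps flip: diff_divide_distrib)
  qed
  have slope_le: "\<bar>slope T u n k\<bar> \<le> C" if "k < n" for n k
  proof -
    have "\<bar>u (T * real (Suc k) / real n) - u (T * real k / real n)\<bar> \<le> C * (T / real n)"
      using is_primitive_lipschitz[OF u C, of "T * real k / real n" "T * real (Suc k) / real n"] nodes[OF that]
      by simp
    then show ?thesis using T that by (simp add: slope_def abs_divide abs_mult divide_simps)
  qed
  have bound: "\<bar>step_fun T n (slope T u n) t\<bar> \<le> C" for n t
  proof (cases "n > 0 \<and> t \<in> {0..<T}")
    case True
    then obtain k where "k < n" "t \<in> cell T n k" using ex_cell[OF T, of n t] by auto
    then show ?thesis using slope_le by (simp add: step_fun_cell[OF T])
  next
    case False
    then have "step_fun T n (slope T u n) t = 0"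
      using step_fun_outside[OF T, of t n] by (auto simp: step_fun_def)
    then show ?thesis using C0 by simp
  qed
  have "(\<lambda>n. \<integral>t. indicator {0..T} t *\<^sub>R \<bar>f t - step_fun T n (slope T u n) t\<bar> \<partial>lebesgue)
      \<longlonglongrightarrow> (\<integral>t. 0 \<partial>(lebesgue :: real measure))"
  proof (rule integral_dominated_convergence[where w="\<lambda>t. 2 * C * indicator {0..T} t"])
    show "integrable lebesgue (\<lambda>t. 2 * C * indicat_real {0..T} t)"
      by (intro integrable_mult_right integrable_real_indicator) (auto simp: emeasure_lborel_Icc_eq)
    show "AE t in lebesgue. norm (indicat_real {0..T} t *\<^sub>R \<bar>f t - step_fun T n (slope T u n) t\<bar>)
        \<le> 2 * C * indicat_real {0..T} t" for n
    proof (rule AE_I2)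
      fix t show "norm (indicat_real {0..T} t *\<^sub>R \<bar>f t - step_fun T n (slope T u n) t\<bar>) \<le> 2 * C * indicat_real {0..T} t"
        using C[of t] bound[of n t] by (auto simp: indicator_def)
    qed
    have "AE t in lebesgue. t \<noteq> T" by (rule AE_completion[OF AE_lborel_singleton])
    then show "AE t in lebesgue. (\<lambda>n. indicat_real {0..T} t *\<^sub>R \<bar>f t - step_fun T n (slope T u n) t\<bar>) \<longlonglongrightarrow> 0"
      using lebesgue_differentiation[OF is_primitive_integrable[OF u]]
    proof eventually_elim
      case (elim t)
      show ?case
      proof (cases "t \<in> {0..T}")
        case False
        then show ?thesis by simp
      next
        case True
        then have t: "0 \<le> t" "t < T" using elim by auto
        show ?thesis
        proof (rule LIMSEQ_I)
          fix r :: real assume r: "0 < r"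
          then have "r/2 > 0" by simp
          then obtain \<delta> where \<delta>: "\<delta> > 0" "\<And>c d. c < d \<Longrightarrow> c \<le> t \<Longrightarrow> t \<le> d \<Longrightarrow> d - c < \<delta> \<Longrightarrow>
             \<bar>(LINT s:{c..d}|lebesgue. f s) - f t * (d - c)\<bar> \<le> r/2 * (d - c)"
            using elim(2) by blast
          obtain N :: nat where N: "T / \<delta> < real N" using reals_Archimedean2 by blast
          have "0 < T / \<delta>" using T \<delta>(1) by simp
          then have N0: "0 < real N" using N by linarith
          show "\<exists>no. \<forall>n\<ge>no. norm (indicat_real {0..T} t *\<^sub>R \<bar>f t - step_fun T n (slope T u n) t\<bar> - 0) < r"
          proof (intro exI[of _ N] allI impI)
            fix n assume n: "n \<ge> N"
            then have n0: "n > 0" using N0 by linarith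
            have "T / \<delta> < real n" using N n by linarith
            then have Tn: "T / real n < \<delta>" using \<delta>(1) n0 by (simp add: field_simps)
            obtain k where k: "k < n" "t \<in> cell T n k" using ex_cell[OF T n0 t] .
            let ?c = "T * real k / real n" and ?d = "T * real (Suc k) / real n"
            have "\<bar>(LINT s:{?c..?d}|lebesgue. f s) - f t * (?d - ?c)\<bar> \<le> r/2 * (?d - ?c)"
              using nodes[OF k(1)] k(2) Tn by (intro \<delta>(2)) (auto simp: cell_def)
            also have "(LINT s:{?c..?d}|lebesgue. f s) = u ?d - u ?c"
              using nodes[OF k(1)] by (intro is_primitive_increment[OF u, symmetric]) auto
            also have "?d - ?c = T / real n" by (rule nodes(4)[OF k(1)])
            also have "u ?d - u ?c = slope T u n k * (T / real n)"
              using T n0 by (simp add: slope_def)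
            finally have "\<bar>(slope T u n k - f t) * (T / real n)\<bar> \<le> r/2 * (T / real n)"
              by (simp only: left_diff_distrib)
            then have "\<bar>slope T u n k - f t\<bar> * (T / real n) \<le> r/2 * (T / real n)"
              using T by (simp add: abs_mult)
            moreover have "T / real n > 0" using T n0 by simp
            ultimately have "\<bar>slope T u n k - f t\<bar> \<le> r/2" by (simp only: mult_le_cancel_right_pos)
            then show "norm (indicat_real {0..T} t *\<^sub>R \<bar>f t - step_fun T n (slope T u n) t\<bar> - 0) < r"
              using r abs_minus_commute[of "f t" "slope T u n k"]
              by (simp add: step_fun_cell[OF T k(2,1)] indicator_def)
          qed
        qed
      qed
    qed
    show "(\<lambda>t. indicat_real {0..T} t *\<^sub>R \<bar>f t - step_fun T n (slope T u n) t\<bar>) \<in> borel_measurable lebesgue" for n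
      using set_integrable_abs[OF set_integrable_subset_lebesgue[OF Bochner_Integration.integrable_diff[OF
            is_primitive_integrable[OF u] step_fun_integral(1)[OF T]], of "{0..T}"]]
      by (auto simp: set_integrable_def)
  qed simp
  then show ?thesis by (simp add: set_lebesgue_integral_def)
qed

text \<open>
  The sum is the \<open>L\<^sup>1\<close> norm of the step function of cell averages, which converges to \<open>f\<close>. This is
  how the AC norm is recovered from the values of a function at countably many points.
\<close>

lemma polygonal_variation_tendsto:
  assumes T: "T > 0" and u: "is_primitive 0 T u f" and C: "\<And>t. \<bar>f t\<bar> \<le> C"
  shows "(\<lambda>n. \<Sum>i<n. \<bar>u (T * real (Suc i) / real n) - u (T * real i / real n)\<bar>)
           \<longlonglongrightarrow> (LINT t:{0..T}|lebesgue. \<bar>f t\<bar>)"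
proof -
  let ?S = "\<lambda>n. step_fun T n (slope T u n)"
  have sum_eq: "(\<Sum>i<n. \<bar>u (T * real (Suc i) / real n) - u (T * real i / real n)\<bar>) =
      (LINT t:{0..T}|lebesgue. \<bar>?S n t\<bar>)" for n
    unfolding step_fun_abs_integral[OF T] using T
    by (intro sum.cong) (auto simp: slope_def abs_divide abs_mult)
  have sf: "set_integrable lebesgue {0..T} f"
    using u by (intro set_integrable_subset_lebesgue) auto
  have sS: "set_integrable lebesgue {0..T} (?S n)" for n
    by (intro set_integrable_subset_lebesgue step_fun_integral(1)[OF T]) auto
  note sd = set_integrable_abs[OF set_integral_diff(1)[OF sf sS]]
  have le: "\<bar>(LINT t:{0..T}|lebesgue. \<bar>?S n t\<bar>) - (LINT t:{0..T}|lebesgue. \<bar>f t\<bar>)\<bar> \<le>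
      (LINT t:{0..T}|lebesgue. \<bar>f t - ?S n t\<bar>)" for n
  proof -
    have "(LINT t:{0..T}|lebesgue. \<bar>?S n t\<bar>) \<le> (LINT t:{0..T}|lebesgue. \<bar>f t\<bar> + \<bar>f t - ?S n t\<bar>)"
      by (rule set_integral_mono[OF set_integrable_abs[OF sS] set_integral_add(1)[OF set_integrable_abs[OF sf] sd]])
        linarith
    moreover have "(LINT t:{0..T}|lebesgue. \<bar>f t\<bar>) \<le> (LINT t:{0..T}|lebesgue. \<bar>?S n t\<bar> + \<bar>f t - ?S n t\<bar>)"
      by (rule set_integral_mono[OF set_integrable_abs[OF sf] set_integral_add(1)[OF set_integrable_abs[OF sS] sd]])
        linarith
    ultimately show ?thesis
      unfolding set_integral_add(2)[OF set_integrable_abs[OF sf] sd]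
        set_integral_add(2)[OF set_integrable_abs[OF sS] sd] by linarith
  qed
  have "(\<lambda>n. (LINT t:{0..T}|lebesgue. \<bar>?S n t\<bar>) - (LINT t:{0..T}|lebesgue. \<bar>f t\<bar>)) \<longlonglongrightarrow> 0"
    by (rule Lim_null_comparison[OF _ averages_tendsto_L1[OF T u C]]) (use le in auto)
  then show ?thesis unfolding sum_eq by (simp add: LIM_zero_iff)
qed

text \<open>
  The cell averages of \<open>f\<close> are moved to nearby rationals. Lists of rationals form a countable type,
  with the number of cells encoded as the length.
\<close>

lemma rational_step_dense:
  assumes T: "T > 0" and f: "integrable lebesgue f" and C: "\<And>t. \<bar>f t\<bar> \<le> C" and e: "e > 0"
  obtains cs :: "rat list" where
    "(LINT t:{0..T}|lebesgue. \<bar>f t - step_fun T (length cs) (\<lambda>i. of_rat (cs ! i)) t\<bar>) < e"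
proof -
  define u where "u = (\<lambda>t\<in>{0..T}. 0 + (LINT s:{0..t}|lebesgue. f s))"
  have u: "is_primitive 0 T u f"
    unfolding u_def using T by (intro is_primitive_indefinite_integral[OF f]) simp
  let ?S = "\<lambda>n. step_fun T n (slope T u n)"
  have "\<forall>\<^sub>F n in sequentially. (LINT t:{0..T}|lebesgue. \<bar>f t - ?S n t\<bar>) < e/2"
    using e by (intro order_tendstoD(2)[OF averages_tendsto_L1[OF T u C]]) simp
  with eventually_gt_at_top[of 0] have "\<forall>\<^sub>F n in sequentially. n > 0 \<and> (LINT t:{0..T}|lebesgue. \<bar>f t - ?S n t\<bar>) < e/2"
    by eventually_elim auto
  then obtain n where n: "n > 0" "(LINT t:{0..T}|lebesgue. \<bar>f t - ?S n t\<bar>) < e/2"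
    by (auto simp: eventually_sequentially)
  \<comment> \<open>an error \<open>e / (2 T)\<close> in each value costs at most \<open>e/2\<close> after integration over \<open>[0,T]\<close>\<close>
  have "\<exists>q. \<bar>slope T u n i - of_rat q\<bar> < e / (2 * T)" for i
  proof -
    have "slope T u n i < slope T u n i + e / (2 * T)" using e T by simp
    then obtain q where "slope T u n i < of_rat q" "of_rat q < slope T u n i + e / (2 * T)"
      using of_rat_dense by blast
    then show ?thesis by (intro exI[of _ q]) auto
  qed
  then obtain q where q: "\<And>i. \<bar>slope T u n i - of_rat (q i)\<bar> < e / (2 * T)" by metis
  define cs where "cs = map q [0..<n]"
  let ?Q = "step_fun T (length cs) (\<lambda>i. of_rat (cs ! i))"
  have Q: "?Q = step_fun T n (\<lambda>i. of_rat (q i))"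
    by (auto simp: cs_def step_fun_def fun_eq_iff)
  have si: "set_integrable lebesgue {0..T} g" if "integrable lebesgue g" for g :: "real \<Rightarrow> real"
    using that by (intro set_integrable_subset_lebesgue) auto
  note S = step_fun_integral(1)[OF T]
  have A: "set_integrable lebesgue {0..T} (\<lambda>t. \<bar>f t - ?S n t\<bar>)" "set_integrable lebesgue {0..T} (\<lambda>t. \<bar>?S n t - ?Q t\<bar>)"
    "set_integrable lebesgue {0..T} (\<lambda>t. \<bar>f t - ?Q t\<bar>)"
    unfolding Q using f S by (intro set_integrable_abs si Bochner_Integration.integrable_diff; simp)+
  have "(LINT t:{0..T}|lebesgue. \<bar>?S n t - ?Q t\<bar>) = (\<Sum>i<n. \<bar>slope T u n i - of_rat (q i)\<bar> * (T / real n))"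
    unfolding Q step_fun_abs_integral[OF T, symmetric] using step_fun_combine[OF T, of "(-)" n] by simp
  also have "\<dots> \<le> (\<Sum>i<n. e / (2 * T) * (T / real n))"
    using q T by (intro sum_mono mult_right_mono) (auto intro: less_imp_le)
  also have "\<dots> = e/2" using T n(1) by simp
  finally have SQ: "(LINT t:{0..T}|lebesgue. \<bar>?S n t - ?Q t\<bar>) \<le> e/2" .
  have "(LINT t:{0..T}|lebesgue. \<bar>f t - ?Q t\<bar>) \<le> (LINT t:{0..T}|lebesgue. \<bar>f t - ?S n t\<bar> + \<bar>?S n t - ?Q t\<bar>)"
    by (rule set_integral_mono[OF A(3) set_integral_add(1)[OF A(1,2)]]) linarith
  also have "\<dots> = (LINT t:{0..T}|lebesgue. \<bar>f t - ?S n t\<bar>) + (LINT t:{0..T}|lebesgue. \<bar>?S n t - ?Q t\<bar>)"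
    by (rule set_integral_add(2)[OF A(1,2)])
  also have "\<dots> < e" using n(2) SQ by linarith
  finally show ?thesis by (rule that)
qed


section \<open>Delay integrals against bounded signed measures\<close>

lemma sets_jordan_pos [simp, measurable_cong]: "sets (jordan_pos M \<nu>) = sets M"
  by (simp add: jordan_pos_def sets.sigma_sets_eq)

lemma space_jordan_pos [simp]: "space (jordan_pos M \<nu>) = space M"
  by (simp add: jordan_pos_def)

text \<open>
  Unlike the extensional signed measures of bounded total variation, such set functions are closed
  under negation, so that both parts of the Jordan decomposition can be treated alike.
\<close>

definition bounded_charge :: "'a measure \<Rightarrow> real \<Rightarrow> ('a set \<Rightarrow> real) \<Rightarrow> bool" where
  "bounded_charge M K \<nu> \<longleftrightarrow>
     (\<forall>A :: nat \<Rightarrow> 'a set. range A \<subseteq> sets M \<longrightarrow> disjoint_family A \<longrightarrow>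
        (\<lambda>n. \<nu> (A n)) sums \<nu> (\<Union>n. A n)) \<and> (\<forall>B\<in>sets M. \<bar>\<nu> B\<bar> \<le> K)"

lemma bounded_charge_minus: "bounded_charge M K \<nu> \<Longrightarrow> bounded_charge M K (\<lambda>A. - \<nu> A)"
  unfolding bounded_charge_def by (auto intro!: sums_minus)

lemma tv_norm_bounded_charge:
  assumes \<nu>: "signed_measure M \<nu>" and tv: "tv_norm M \<nu> \<le> ennreal K" and K: "K \<ge> 0"
  shows "bounded_charge M K \<nu>"
  unfolding bounded_charge_def
proof (intro conjI ballI)
  fix B assume B: "B \<in> sets M"
  let ?P = "{B, space M - B}"
  have "ennreal \<bar>\<nu> B\<bar> \<le> (\<Sum>A\<in>?P. ennreal \<bar>\<nu> A\<bar>)"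
    by (rule member_le_sum) auto
  also have "\<dots> \<le> tv_norm M \<nu>"
    unfolding tv_norm_def using B sets.sets_into_space[OF B]
    by (intro SUP_upper) (auto simp: disjoint_def)
  also have "\<dots> \<le> ennreal K" by (rule tv)
  finally show "\<bar>\<nu> B\<bar> \<le> K" using K by simp
qed (use \<nu> in \<open>auto simp: signed_measure_def\<close>)

lemma emeasure_jordan_pos_space_le:
  assumes \<nu>: "bounded_charge M K \<nu>"
  shows "emeasure (jordan_pos M \<nu>) (space M) \<le> ennreal K"
proof -
  have "emeasure (jordan_pos M \<nu>) (space M) = (SUP B \<in> {B \<in> sets M. B \<subseteq> space M}. ennreal (\<nu> B))"
    using \<nu> by (intro emeasure_jordan_pos) (auto simp: bounded_charge_def)
  also have "\<dots> \<le> ennreal K"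
    using \<nu> by (intro SUP_least ennreal_leI) (force simp: bounded_charge_def)
  finally show ?thesis .
qed

lemma jordan_pos_integral:
  assumes \<nu>: "bounded_charge M K \<nu>" and K: "K \<ge> 0"
    and f: "f \<in> borel_measurable M" and B: "\<And>s. s \<in> space M \<Longrightarrow> \<bar>f s\<bar> \<le> B" and B0: "B \<ge> 0"
  shows "integrable (jordan_pos M \<nu>) f" "\<bar>\<integral>s. f s \<partial>jordan_pos M \<nu>\<bar> \<le> K * B"
proof -
  have fin: "emeasure (jordan_pos M \<nu>) (space (jordan_pos M \<nu>)) \<le> ennreal K"
    using emeasure_jordan_pos_space_le[OF \<nu>] by simp
  then have "emeasure (jordan_pos M \<nu>) (space (jordan_pos M \<nu>)) \<noteq> \<infinity>" by (auto simp: top_unique)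
  then interpret finite_measure "jordan_pos M \<nu>" by (rule finite_measureI)
  have fm: "f \<in> borel_measurable (jordan_pos M \<nu>)" using f by measurable
  show int: "integrable (jordan_pos M \<nu>) f"
    by (rule integrable_const_bound[where B=B]) (use B fm in auto)
  have "\<bar>\<integral>s. f s \<partial>jordan_pos M \<nu>\<bar> \<le> (\<integral>s. \<bar>f s\<bar> \<partial>jordan_pos M \<nu>)"
    by (rule integral_abs_bound)
  also have "\<dots> \<le> (\<integral>s. B \<partial>jordan_pos M \<nu>)"
    using int B by (intro integral_mono) auto
  also have "\<dots> = measure (jordan_pos M \<nu>) (space M) * B" by simp
  also have "\<dots> \<le> K * B"
    using fin K B0 by (intro mult_right_mono) (auto simp: measure_def intro: enn2real_leI)
  finally show "\<bar>\<integral>s. f s \<partial>jordan_pos M \<nu>\<bar> \<le> K * B" .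
qed

lemma signed_integral_bound:
  assumes \<nu>: "bounded_charge M K \<nu>" and K: "K \<ge> 0"
    and f: "f \<in> borel_measurable M" and B: "\<And>s. s \<in> space M \<Longrightarrow> \<bar>f s\<bar> \<le> B" and B0: "B \<ge> 0"
  shows "\<bar>signed_integral M \<nu> f\<bar> \<le> 2 * K * B"
  using jordan_pos_integral(2)[OF \<nu> K f B B0] jordan_pos_integral(2)[OF bounded_charge_minus[OF \<nu>] K f B B0]
  unfolding signed_integral_def by linarith

lemma signed_integral_diff:
  assumes \<nu>: "bounded_charge M K \<nu>" and K: "K \<ge> 0"
    and f: "f \<in> borel_measurable M" "\<And>s. s \<in> space M \<Longrightarrow> \<bar>f s\<bar> \<le> B"
    and g: "g \<in> borel_measurable M" "\<And>s. s \<in> space M \<Longrightarrow> \<bar>g s\<bar> \<le> B" and B0: "B \<ge> 0"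
  shows "signed_integral M \<nu> (\<lambda>s. f s - g s) = signed_integral M \<nu> f - signed_integral M \<nu> g"
  using jordan_pos_integral(1)[OF \<nu> K f B0] jordan_pos_integral(1)[OF bounded_charge_minus[OF \<nu>] K f B0]
    jordan_pos_integral(1)[OF \<nu> K g B0] jordan_pos_integral(1)[OF bounded_charge_minus[OF \<nu>] K g B0]
  unfolding signed_integral_def by simp

lemma delay_shift_continuous_measurable:
  assumes y: "continuous_on {-1..T} y" and \<tau>: "\<tau> \<in> {0..T}"
  shows "continuous_on {-1..0} (\<lambda>s. y (\<tau> + s))" "(\<lambda>s. y (\<tau> + s)) \<in> borel_measurable delay_interval"
proof -
  show c: "continuous_on {-1..0} (\<lambda>s. y (\<tau> + s))"
    by (rule continuous_on_compose2[OF y]) (use \<tau> in \<open>auto intro!: continuous_intros\<close>)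
  then show "(\<lambda>s. y (\<tau> + s)) \<in> borel_measurable delay_interval"
    by (rule borel_measurable_continuous_on_restrict)
qed

text \<open>
  Measurability in \<open>\<tau>\<close> is only given for a fixed test function. So \<open>\<tau>\<close> is rounded down to a multiple
  of \<open>1/n\<close> inside \<open>y\<close> but not in \<open>\<mu>\<close>: the result is glued from countably many measurable functions,
  and it converges to the integrand because \<open>y\<close> is uniformly continuous and the total variations
  are bounded.
\<close>

lemma delay_integrand:
  assumes K: "K \<ge> 0" and T: "T > 0" and \<mu>: "\<mu> \<in> ms_T K T" and y: "continuous_on {-1..T} y"
  defines "g \<equiv> \<lambda>\<tau>. signed_integral delay_interval (\<mu> \<tau>) (\<lambda>s. y (\<tau> + s))"
  shows "\<exists>C. \<forall>\<tau>\<in>{0..T}. \<bar>g \<tau>\<bar> \<le> C" and "g \<in> borel_measurable (lebesgue_on {0..T})"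
proof -
  have charge: "bounded_charge delay_interval K (\<mu> \<tau>)" if "\<tau> \<in> {0..T}" for \<tau>
    using \<mu> that K by (intro tv_norm_bounded_charge) (auto simp: ms_T_def ms_def)
  have sp: "space delay_interval = {-1..0}" by (simp add: space_restrict_space)
  obtain B where B: "\<And>r. r \<in> {-1..T} \<Longrightarrow> \<bar>y r\<bar> \<le> B" "B \<ge> 0"
  proof -
    have "bounded (y ` {-1..T})"
      using y by (intro compact_imp_bounded compact_continuous_image) auto
    then obtain B where B: "\<forall>r\<in>{-1..T}. norm (y r) \<le> B" unfolding bounded_iff by blast
    then have "norm (y 0) \<le> B" using T by simp
    then have "0 \<le> B" by (rule order_trans[OF norm_ge_zero])
    then show thesis using B by (intro that[of B]) auto
  qed
  have "\<bar>g \<tau>\<bar> \<le> 2 * K * B" if "\<tau> \<in> {0..T}" for \<tau>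
    unfolding g_def using that B
    by (intro signed_integral_bound[OF charge[OF that] K delay_shift_continuous_measurable(2)[OF y that]]) (auto simp: sp)
  then show "\<exists>C. \<forall>\<tau>\<in>{0..T}. \<bar>g \<tau>\<bar> \<le> C" by blast
  define r where "r n \<tau> = \<lfloor>real n * \<tau>\<rfloor>" for n and \<tau> :: real
  \<comment> \<open>the rounded time \<open>k/n\<close> is a parameter; off \<open>[0,T]\<close> the shifted test function may be discontinuous, and the default 0 keeps \<open>h\<close> measurable\<close>
  define h where "h n k \<tau> = (if real_of_int k / real n \<in> {0..T}
      then signed_integral delay_interval (\<mu> \<tau>) (\<lambda>s. y (real_of_int k / real n + s)) else 0)" for n k \<tau>
  have hm: "h n k \<in> borel_measurable (lebesgue_on {0..T})" for n k
  proof (cases "real_of_int k / real n \<in> {0..T}")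
    case True
    have "(\<lambda>t. signed_integral delay_interval (\<mu> t) (\<lambda>s. y (real_of_int k / real n + s)))
        \<in> borel_measurable (lebesgue_on {0..T})"
      using \<mu> delay_shift_continuous_measurable(1)[OF y True] unfolding ms_T_def by blast
    moreover have "h n k = (\<lambda>t. signed_integral delay_interval (\<mu> t) (\<lambda>s. y (real_of_int k / real n + s)))"
      using True by (intro ext) (simp only: h_def if_True)
    ultimately show ?thesis by simp
  next
    case False
    then have "h n k = (\<lambda>_. 0)" by (intro ext) (simp only: h_def if_False)
    then show ?thesis by simp
  qed
  have rm: "r n \<in> measurable (lebesgue_on {0..T}) (count_space UNIV)" for n
  proof -
    have "r n \<in> borel \<rightarrow>\<^sub>M count_space UNIV" unfolding r_def by measurable
    then have "r n \<in> lebesgue \<rightarrow>\<^sub>M count_space UNIV" by (intro measurable_completion) simp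
    then show ?thesis by (rule measurable_restrict_space1)
  qed
  show "g \<in> borel_measurable (lebesgue_on {0..T})"
  proof (rule borel_measurable_LIMSEQ_real)
    show "(\<lambda>\<tau>. h n (r n \<tau>) \<tau>) \<in> borel_measurable (lebesgue_on {0..T})" for n
      by (rule measurable_compose_countable[OF hm rm])
    fix \<tau> assume "\<tau> \<in> space (lebesgue_on {0..T})"
    then have \<tau>: "\<tau> \<in> {0..T}" by (simp add: space_restrict_space)
    show "(\<lambda>n. h n (r n \<tau>) \<tau>) \<longlonglongrightarrow> g \<tau>"
    proof (rule LIMSEQ_I)
      fix e :: real assume e: "0 < e"
      \<comment> \<open>chosen so that \<open>2 K \<eta> < e\<close>, also for \<open>K = 0\<close>\<close>
      define \<eta> where "\<eta> = e / (2 * K + 1) / 2"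
      have \<eta>: "\<eta> > 0" using e K by (simp add: \<eta>_def)
      have "uniformly_continuous_on {-1..T} y"
        using y by (intro compact_uniformly_continuous) auto
      then obtain \<delta> where \<delta>: "\<delta> > 0"
        "\<And>p q. p \<in> {-1..T} \<Longrightarrow> q \<in> {-1..T} \<Longrightarrow> dist q p < \<delta> \<Longrightarrow> dist (y q) (y p) < \<eta>"
        using \<eta> unfolding uniformly_continuous_on_def by meson
      obtain N :: nat where N: "1 / \<delta> < real N" using reals_Archimedean2 by blast
      have "0 < 1 / \<delta>" using \<delta>(1) by simp
      then have N0: "0 < real N" using N by linarith
      show "\<exists>no. \<forall>n\<ge>no. norm (h n (r n \<tau>) \<tau> - g \<tau>) < e"
      proof (intro exI[of _ N] allI impI)
        fix n assume n: "n \<ge> N"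
        then have n0: "real n > 0" using N0 by linarith
        have "1 / \<delta> < real n" using N n by linarith
        then have n1: "1 / real n < \<delta>" using \<delta>(1) n0 by (simp add: field_simps)
        define p where "p = real_of_int (r n \<tau>) / real n"
        have "real_of_int (r n \<tau>) \<le> real n * \<tau>" "real n * \<tau> < real_of_int (r n \<tau>) + 1"
          unfolding r_def by linarith+
        then have p: "p \<le> \<tau>" "\<tau> < p + 1 / real n"
          using n0 by (auto simp: p_def field_simps)
        have "0 \<le> r n \<tau>" using \<tau> n0 by (simp add: r_def)
        then have pT: "p \<in> {0..T}" using p \<tau> n0 by (auto simp: p_def)
        have diff: "signed_integral delay_interval (\<mu> \<tau>) (\<lambda>s. y (p + s) - y (\<tau> + s)) =
            signed_integral delay_interval (\<mu> \<tau>) (\<lambda>s. y (p + s)) - g \<tau>"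
          unfolding g_def using pT \<tau> B
          by (intro signed_integral_diff[OF charge[OF \<tau>] K delay_shift_continuous_measurable(2)[OF y pT] _
                delay_shift_continuous_measurable(2)[OF y \<tau>]]) (auto simp: sp)
        have "\<bar>signed_integral delay_interval (\<mu> \<tau>) (\<lambda>s. y (p + s) - y (\<tau> + s))\<bar> \<le> 2 * K * \<eta>"
        proof (rule signed_integral_bound[OF charge[OF \<tau>] K])
          show "(\<lambda>s. y (p + s) - y (\<tau> + s)) \<in> borel_measurable delay_interval"
            using delay_shift_continuous_measurable(2)[OF y pT] delay_shift_continuous_measurable(2)[OF y \<tau>] by measurable
          fix s assume "s \<in> space delay_interval"
          then have "s \<in> {-1..0}" by (simp add: sp)
          then have "dist (y (p + s)) (y (\<tau> + s)) < \<eta>"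
            using pT \<tau> p n1 by (intro \<delta>(2)) (auto simp: dist_real_def)
          then show "\<bar>y (p + s) - y (\<tau> + s)\<bar> \<le> \<eta>" by (simp add: dist_real_def)
        qed (use \<eta> in simp)
        moreover have "h n (r n \<tau>) \<tau> = signed_integral delay_interval (\<mu> \<tau>) (\<lambda>s. y (p + s))"
          using pT by (simp add: h_def p_def)
        moreover have "2 * K * \<eta> < e"
        proof -
          have "2 * K * \<eta> \<le> (2 * K + 1) * \<eta>" using \<eta> by (simp add: algebra_simps)
          also have "\<dots> = e / 2"
          proof -
            have "2 * K + 1 \<noteq> 0" using K by linarith
            then show ?thesis
              unfolding \<eta>_def times_divide_eq_right by (subst nonzero_mult_div_cancel_left) auto
          qed
          finally show ?thesis using e by linarith
        qed
        ultimately show "norm (h n (r n \<tau>) \<tau> - g \<tau>) < e" using diff by simp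
      qed
    qed
  qed
qed

text \<open>
  A monotone 1-Lipschitz change of variable turns nonoverlapping intervals into nonoverlapping
  intervals that are no longer; it is used for the projections \<open>r \<mapsto> min r 0\<close> and \<open>r \<mapsto> max r 0\<close>.
\<close>

lemma abs_cont_compose_mono:
  fixes \<phi> :: "real \<Rightarrow> real"
  assumes u: "abs_cont a b u" and range: "\<And>r. p \<le> r \<Longrightarrow> r \<le> q \<Longrightarrow> a \<le> \<phi> r \<and> \<phi> r \<le> b"
    and mono: "\<And>c d. c \<le> d \<Longrightarrow> \<phi> c \<le> \<phi> d" and lip: "\<And>c d. c \<le> d \<Longrightarrow> \<phi> d - \<phi> c \<le> d - c"
  shows "abs_cont p q (\<lambda>r. u (\<phi> r))"
  unfolding abs_cont_def
proof (intro allI impI)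
  fix \<epsilon> :: real assume "\<epsilon> > 0"
  then obtain \<delta> where \<delta>: "\<delta> > 0" "\<And>(n::nat) c d. (\<forall>i<n. a \<le> c i \<and> c i \<le> d i \<and> d i \<le> b) \<Longrightarrow>
        disjoint_family_on (\<lambda>i. {c i<..<d i}) {..<n} \<Longrightarrow>
        (\<Sum>i<n. d i - c i) < \<delta> \<Longrightarrow> (\<Sum>i<n. \<bar>u (d i) - u (c i)\<bar>) < \<epsilon>"
    using u unfolding abs_cont_def by meson
  show "\<exists>\<delta>>0. \<forall>(n::nat) c d. (\<forall>i<n. p \<le> c i \<and> c i \<le> d i \<and> d i \<le> q) \<longrightarrow>
        disjoint_family_on (\<lambda>i. {c i<..<d i}) {..<n} \<longrightarrow>
        (\<Sum>i<n. d i - c i) < \<delta> \<longrightarrow> (\<Sum>i<n. \<bar>u (\<phi> (d i)) - u (\<phi> (c i))\<bar>) < \<epsilon>"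
  proof (intro exI[of _ \<delta>] conjI allI impI)
    fix n :: nat and c d :: "nat \<Rightarrow> real"
    assume cd: "\<forall>i<n. p \<le> c i \<and> c i \<le> d i \<and> d i \<le> q"
      and disj: "disjoint_family_on (\<lambda>i. {c i<..<d i}) {..<n}" and len: "(\<Sum>i<n. d i - c i) < \<delta>"
    show "(\<Sum>i<n. \<bar>u (\<phi> (d i)) - u (\<phi> (c i))\<bar>) < \<epsilon>"
    proof (rule \<delta>(2))
      show "\<forall>i<n. a \<le> \<phi> (c i) \<and> \<phi> (c i) \<le> \<phi> (d i) \<and> \<phi> (d i) \<le> b"
      proof (intro allI impI)
        fix i assume "i < n"
        then have "p \<le> c i" "c i \<le> d i" "d i \<le> q" using cd by auto
        then show "a \<le> \<phi> (c i) \<and> \<phi> (c i) \<le> \<phi> (d i) \<and> \<phi> (d i) \<le> b"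
          using range[of "c i"] range[of "d i"] mono[of "c i" "d i"] by linarith
      qed
      show "disjoint_family_on (\<lambda>i. {\<phi> (c i)<..<\<phi> (d i)}) {..<n}"
        unfolding disjoint_family_on_def
      proof (intro ballI impI)
        fix i j assume ij: "i \<in> {..<n}" "j \<in> {..<n}" "i \<noteq> j"
        then have "{c i<..<d i} \<inter> {c j<..<d j} = {}" using disj by (auto simp: disjoint_family_on_def)
        then have "min (d i) (d j) \<le> max (c i) (c j)" by simp
        then have "d i \<le> c i \<or> d i \<le> c j \<or> d j \<le> c i \<or> d j \<le> c j"
          by (auto simp: min_def max_def split: if_splits)
        then have "\<phi> (d i) \<le> \<phi> (c i) \<or> \<phi> (d i) \<le> \<phi> (c j) \<or> \<phi> (d j) \<le> \<phi> (c i) \<or> \<phi> (d j) \<le> \<phi> (c j)"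
          using mono by blast
        then show "{\<phi> (c i)<..<\<phi> (d i)} \<inter> {\<phi> (c j)<..<\<phi> (d j)} = {}" by auto
      qed
      have "(\<Sum>i<n. \<phi> (d i) - \<phi> (c i)) \<le> (\<Sum>i<n. d i - c i)"
        using cd lip by (intro sum_mono) auto
      then show "(\<Sum>i<n. \<phi> (d i) - \<phi> (c i)) < \<delta>" using len by linarith
    qed
  qed (use \<delta> in auto)
qed

text \<open>
  This makes the extension of \<open>x\<close> an admissible test function in the generators of \<open>\<Sigma>\<^sub>T\<close>.
\<close>

lemma extend_mem_AC:
  assumes u: "u0 \<in> AC (-1) 0" and x: "x \<in> AC_from u0 T" and T: "T > 0"
  shows "extend u0 x \<in> AC (-1) T"
proof -
  have x': "x \<in> AC 0 T" "x 0 = u0 0" using x by (auto simp: AC_from_def)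
  have "extend u0 x \<in> extensional {-1..T}"
    using u x' T unfolding AC_def extensional_def extend_def by auto
  moreover have "abs_cont (-1) T (extend u0 x)"
  proof (rule abs_cont_combine)
    show "abs_cont (-1) T (\<lambda>r. u0 (min r 0))"
      using u by (intro abs_cont_compose_mono[of "-1" 0 u0 _ _ "\<lambda>r. min r 0"]) (auto simp: AC_def)
    show "abs_cont (-1) T (\<lambda>r. x (max r 0))"
      using x' T by (intro abs_cont_compose_mono[of 0 T x _ _ "\<lambda>r. max r 0"]) (auto simp: AC_def)
    show "\<bar>extend u0 x d - extend u0 x c\<bar> \<le> \<bar>u0 (min d 0) - u0 (min c 0)\<bar> + \<bar>x (max d 0) - x (max c 0)\<bar>"
      if "c \<le> d" for c d
      using that x'(2) by (auto simp: extend_def min_def max_def)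
  qed
  ultimately show ?thesis by (simp add: AC_def)
qed


section \<open>Measurability of the continuation operator\<close>

lemma space_Sigma_T: "space (Sigma_T K T) = ms_T K T"
  unfolding Sigma_T_def by (rule space_measure_of) auto

lemma delay_integral_measurable:
  assumes "y \<in> AC (-1) T" "t \<in> {0..T}"
  shows "(\<lambda>\<mu>. delay_integral y \<mu> t) \<in> borel_measurable (Sigma_T K T)"
proof (rule measurableI)
  fix B :: "real set" assume B: "B \<in> sets borel"
  have "{\<mu> \<in> ms_T K T. delay_integral y \<mu> t \<in> B} \<in> sets (Sigma_T K T)"
    unfolding Sigma_T_def using assms B by (intro in_measure_of) auto
  then show "(\<lambda>\<mu>. delay_integral y \<mu> t) -` B \<inter> space (Sigma_T K T) \<in> sets (Sigma_T K T)"
    by (simp add: space_Sigma_T vimage_def Int_def conj_commute)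
qed auto

lemma continuation_primitive:
  assumes K: "K \<ge> 0" and T: "T > 0" and \<mu>: "\<mu> \<in> ms_T K T"
    and y: "continuous_on {-1..T} (extend u0 x)"
  obtains f C where "is_primitive 0 T (continuation u0 T \<mu> x) f" "\<And>t. \<bar>f t\<bar> \<le> C"
proof -
  define g where "g \<tau> = signed_integral delay_interval (\<mu> \<tau>) (\<lambda>s. extend u0 x (\<tau> + s))" for \<tau>
  obtain C where C: "\<And>\<tau>. \<tau> \<in> {0..T} \<Longrightarrow> \<bar>g \<tau>\<bar> \<le> C"
    using delay_integrand(1)[OF K T \<mu> y] unfolding g_def by blast
  have gm: "g \<in> borel_measurable (lebesgue_on {0..T})"
    using delay_integrand(2)[OF K T \<mu> y] unfolding g_def .
  define f where "f \<tau> = indicator {0..T} \<tau> *\<^sub>R g \<tau>" for \<tau>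
  have "finite_measure (lebesgue_on {0..T})"
    by (rule finite_measure_lebesgue_on) auto
  then have "integrable (lebesgue_on {0..T}) g"
    by (rule finite_measure.integrable_const_bound[where B=C]) (use C gm in \<open>auto intro!: AE_I2\<close>)
  then have f: "integrable lebesgue f"
    unfolding f_def by (subst (asm) integrable_restrict_space) auto
  have eq: "continuation u0 T \<mu> x = (\<lambda>t\<in>{0..T}. u0 0 + (LINT s:{0..t}|lebesgue. f s))"
    unfolding continuation_def
  proof (rule restrict_ext)
    fix t assume t: "t \<in> {0..T}"
    have "delay_integral (extend u0 x) \<mu> t = (LINT s:{0..t}|lebesgue. f s)"
      unfolding delay_integral_def using t
      by (intro set_lebesgue_integral_cong) (auto simp: f_def g_def)
    then show "u0 0 + delay_integral (extend u0 x) \<mu> t = u0 0 + (LINT s:{0..t}|lebesgue. f s)" by simp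
  qed
  have "is_primitive 0 T (continuation u0 T \<mu> x) f"
    unfolding eq using T by (intro is_primitive_indefinite_integral[OF f]) simp
  moreover have "\<bar>f t\<bar> \<le> max C 0" for t
    using C[of t] by (cases "t \<in> {0..T}") (auto simp: f_def)
  ultimately show ?thesis by (rule that)
qed

theorem lemma7p4:
  fixes T K :: real and u0 x :: "real \<Rightarrow> real"
  assumes "T > 0" and "K > 0"
    and "u0 \<in> AC (-1) 0"
    and "x \<in> AC_from u0 T"
  shows "(\<lambda>\<mu>. continuation u0 T \<mu> x) \<in> Sigma_T K T \<rightarrow>\<^sub>M borel_AC 0 T"
proof -
  note T = \<open>T > 0\<close>
  define \<Phi> where "\<Phi> \<mu> = continuation u0 T \<mu> x" for \<mu>
  define y where "y = extend u0 x"
  have y: "y \<in> AC (-1) T" unfolding y_def using assms by (intro extend_mem_AC)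
  then have y_cont: "continuous_on {-1..T} (extend u0 x)"
    unfolding y_def AC_def by (auto intro: abs_cont_imp_continuous_on)
  define d where "d = (\<lambda>u v. AC_norm 0 T (\<lambda>t. u t - v t))"
  interpret M: Metric_space "AC 0 T" d
    unfolding d_def using T by (intro Metric_space_AC) simp
  have \<Phi>_ext: "\<Phi> \<mu> \<in> extensional {0..T}" for \<mu>
    unfolding \<Phi>_def continuation_def by simp
  have \<Phi>_AC: "\<Phi> \<mu> \<in> AC 0 T" if \<mu>: "\<mu> \<in> ms_T K T" for \<mu>
  proof -
    obtain f C where f: "is_primitive 0 T (\<Phi> \<mu>) f" "\<And>t. \<bar>f t\<bar> \<le> C"
      using continuation_primitive[OF _ T \<mu> y_cont] \<open>K > 0\<close> unfolding \<Phi>_def by (metis less_imp_le)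
    show ?thesis by (rule is_primitive_bounded_imp_AC[OF f \<Phi>_ext])
  qed
  have \<Phi>_val: "\<Phi> \<mu> t = u0 0 + delay_integral y \<mu> t" if "t \<in> {0..T}" for \<mu> t
    using that by (simp add: \<Phi>_def y_def continuation_def)

  \<comment> \<open>the countable dense set of comparison functions, all starting at \<open>u0 0\<close>\<close>
  define S where "S cs = step_fun T (length cs) (\<lambda>i. of_rat (cs ! i))" for cs :: "rat list"
  define q where "q cs = (\<lambda>t\<in>{0..T}. u0 0 + (LINT s:{0..t}|lebesgue. S cs s))" for cs
  have q: "is_primitive 0 T (q cs) (S cs)" for cs
    unfolding q_def S_def using T
    by (intro is_primitive_indefinite_integral step_fun_integral(1)) auto
  have S_bound: "\<bar>S cs t\<bar> \<le> (\<Sum>i<length cs. \<bar>of_rat (cs ! i)\<bar>)" for cs t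
    unfolding S_def by (rule step_fun_bounded)
  have q_AC: "q cs \<in> AC 0 T" for cs
    by (rule is_primitive_bounded_imp_AC[OF q S_bound]) (simp add: q_def)
  have q0: "q cs 0 = u0 0" for cs
    using T set_integral_lebesgue_point[of 0 "S cs"] by (simp add: q_def)
  have \<Phi>0: "\<Phi> \<mu> 0 = u0 0" for \<mu>
    using T \<Phi>_val[of 0 \<mu>] set_integral_lebesgue_point[of 0] by (simp add: delay_integral_def)

  let ?t = "\<lambda>n i. T * real i / real n"
  have dist_limit: "(\<lambda>n. \<Sum>i<n. \<bar>(\<Phi> \<mu> (?t n (Suc i)) - q cs (?t n (Suc i))) - (\<Phi> \<mu> (?t n i) - q cs (?t n i))\<bar>)
      \<longlonglongrightarrow> d (\<Phi> \<mu>) (q cs)" if \<mu>: "\<mu> \<in> ms_T K T" for \<mu> cs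
  proof -
    obtain f C where f: "is_primitive 0 T (\<Phi> \<mu>) f" "\<And>t. \<bar>f t\<bar> \<le> C"
      using continuation_primitive[OF _ T \<mu> y_cont] \<open>K > 0\<close> unfolding \<Phi>_def by (metis less_imp_le)
    have "\<bar>f t - S cs t\<bar> \<le> C + (\<Sum>i<length cs. \<bar>of_rat (cs ! i)\<bar>)" for t
      using f(2)[of t] S_bound[of cs t] by linarith
    from polygonal_variation_tendsto[OF T is_primitive_diff[OF f(1) q] this]
    show ?thesis
      unfolding d_def AC_norm_diff_primitive[OF f(1) q] by (simp add: \<Phi>0 q0)
  qed
  have dist_measurable: "(\<lambda>\<mu>. d (\<Phi> \<mu>) (q cs)) \<in> borel_measurable (Sigma_T K T)" for cs
  proof (rule borel_measurable_LIMSEQ_real)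
    show "(\<lambda>n. \<Sum>i<n. \<bar>(\<Phi> \<mu> (?t n (Suc i)) - q cs (?t n (Suc i))) - (\<Phi> \<mu> (?t n i) - q cs (?t n i))\<bar>)
      \<longlonglongrightarrow> d (\<Phi> \<mu>) (q cs)" if "\<mu> \<in> space (Sigma_T K T)" for \<mu>
      using that by (intro dist_limit) (simp add: space_Sigma_T)
    fix n
    have node: "(\<lambda>\<mu>. \<Phi> \<mu> (?t n i)) \<in> borel_measurable (Sigma_T K T)" if "i \<le> n" for i
    proof -
      have "?t n i \<le> T" using that T by (cases "n = 0") (auto simp: field_simps)
      then have "?t n i \<in> {0..T}" using T by simp
      then show ?thesis
        using delay_integral_measurable[OF y] by (simp add: \<Phi>_val)
    qed
    show "(\<lambda>\<mu>. \<Sum>i<n. \<bar>(\<Phi> \<mu> (?t n (Suc i)) - q cs (?t n (Suc i))) - (\<Phi> \<mu> (?t n i) - q cs (?t n i))\<bar>)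
        \<in> borel_measurable (Sigma_T K T)"
      by (intro borel_measurable_sum borel_measurable_abs borel_measurable_diff node borel_measurable_const) auto
  qed
  \<comment> \<open>the inverse images of the balls of radius \<open>1/(k+1)\<close> around the comparison functions\<close>
  define W where "W p = {\<mu> \<in> ms_T K T. d (\<Phi> \<mu>) (q (fst p)) < 1 / real (Suc (snd p))}"
    for p :: "rat list \<times> nat"
  have W_sets: "W p \<in> sets (Sigma_T K T)" for p
  proof -
    have "{\<mu> \<in> space (Sigma_T K T). d (\<Phi> \<mu>) (q (fst p)) < 1 / real (Suc (snd p))} \<in> sets (Sigma_T K T)"
      using dist_measurable[of "fst p"] by (rule borel_measurable_less) simp
    then show ?thesis by (simp add: W_def space_Sigma_T)
  qed

  have "\<Phi> \<in> Sigma_T K T \<rightarrow>\<^sub>M borel_AC 0 T"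
    unfolding borel_AC_def
  proof (rule measurable_measure_of)
    show "{U. openin (Metric_space.mtopology (AC 0 T) (\<lambda>u v. AC_norm 0 T (\<lambda>t. u t - v t))) U} \<subseteq> Pow (AC 0 T)"
      using openin_subset M.topspace_mtopology unfolding d_def by auto
    show "\<Phi> \<in> space (Sigma_T K T) \<rightarrow> AC 0 T"
      using \<Phi>_AC by (auto simp: space_Sigma_T)
    fix U assume "U \<in> {U. openin (Metric_space.mtopology (AC 0 T) (\<lambda>u v. AC_norm 0 T (\<lambda>t. u t - v t))) U}"
    then have U: "openin M.mtopology U" unfolding d_def by simp
    define V where "V = \<Phi> -` U \<inter> space (Sigma_T K T)"
    \<comment> \<open>a ball of radius \<open>r\<close> around \<open>\<Phi> \<mu>\<close> inside \<open>U\<close> contains a ball of radius at most \<open>r/2\<close> around a comparison function, which in turn contains \<open>\<Phi> \<mu>\<close>\<close>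
    have "V = (\<Union>p\<in>{p. W p \<subseteq> V}. W p)"
    proof (intro equalityI subsetI)
      fix \<mu> assume "\<mu> \<in> V"
      then have \<mu>: "\<mu> \<in> ms_T K T" "\<Phi> \<mu> \<in> U" by (auto simp: V_def space_Sigma_T)
      obtain r where r: "r > 0" "M.mball (\<Phi> \<mu>) r \<subseteq> U"
        using U \<mu>(2) unfolding M.openin_mtopology by blast
      obtain k where k: "1 / real (Suc k) < r / 2"
        using r(1) by (metis half_gt_zero nat_approx_posE)
      obtain f C where f: "is_primitive 0 T (\<Phi> \<mu>) f" "\<And>t. \<bar>f t\<bar> \<le> C"
        using continuation_primitive[OF _ T \<mu>(1) y_cont] \<open>K > 0\<close> unfolding \<Phi>_def by (metis less_imp_le)
      have "1 / real (Suc k) > 0" by simp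
      then obtain cs where cs: "(LINT t:{0..T}|lebesgue. \<bar>f t - S cs t\<bar>) < 1 / real (Suc k)"
        using rational_step_dense[OF T is_primitive_integrable[OF f(1)] f(2)] unfolding S_def by blast
      then have near: "d (\<Phi> \<mu>) (q cs) < 1 / real (Suc k)"
        unfolding d_def AC_norm_diff_primitive[OF f(1) q] by (simp add: \<Phi>0 q0)
      have "W (cs, k) \<subseteq> V"
      proof
        fix \<nu> assume "\<nu> \<in> W (cs, k)"
        then have \<nu>: "\<nu> \<in> ms_T K T" "d (\<Phi> \<nu>) (q cs) < 1 / real (Suc k)" by (auto simp: W_def)
        have "d (\<Phi> \<mu>) (\<Phi> \<nu>) \<le> d (\<Phi> \<mu>) (q cs) + d (\<Phi> \<nu>) (q cs)"
          using M.triangle'[OF \<Phi>_AC[OF \<mu>(1)] q_AC \<Phi>_AC[OF \<nu>(1)]] .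
        also have "\<dots> < r" using near \<nu>(2) k by linarith
        finally have "\<Phi> \<nu> \<in> M.mball (\<Phi> \<mu>) r" using \<Phi>_AC \<mu>(1) \<nu>(1) by simp
        then show "\<nu> \<in> V" using r(2) \<nu>(1) by (auto simp: V_def space_Sigma_T)
      qed
      moreover have "\<mu> \<in> W (cs, k)" using \<mu>(1) near by (simp add: W_def)
      ultimately show "\<mu> \<in> (\<Union>p\<in>{p. W p \<subseteq> V}. W p)" by blast
    qed blast
    moreover have "(\<Union>p\<in>{p. W p \<subseteq> V}. W p) \<in> sets (Sigma_T K T)"
      using W_sets by (intro sets.countable_UN'') auto
    ultimately have "V \<in> sets (Sigma_T K T)"
      by (rule ssubst[where P="\<lambda>A. A \<in> sets (Sigma_T K T)"])
    then show "\<Phi> -` U \<inter> space (Sigma_T K T) \<in> sets (Sigma_T K T)" by (simp only: V_def)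
  qed
  then show ?thesis unfolding \<Phi>_def .
qed

end
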